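(* Let $b\in\mathbb{R}$, $\sigma>0$, $a\ge0$ with $\sigma^2\le4a$, let $T>0$, $L\in\mathbb{N}$, and let $m,M\in\mathbb{N}$ with $m\le M$. Let $Z$ be a symmetric real random variable with $\mathbb{E}[|Z|^k]<\infty$ for all $k\in\mathbb{N}$, $\mathbb{E}[Z^2]=1$, $\mathbb{E}[Z^4]=3$, having a density $\eta\in\mathcal{C}^M(\mathbb{R})$ such that $|\eta^{(i)}(z)|=o(|z|^{-(2L+i)})$ as $|z|\to\infty$ for all $i\in\{0,\dots,M\}$, and such that $\eta^*_{m'}\ge0$ on $\mathbb{R}$ for all $1\le m'\le M$. For $n\ge1$, $l\in\mathbb{N}$ let $h_l=T/n^l$ and $Q_lf(y)=\mathbb{E}[f(\hat Y^y_{h_l})]$, where $\hat Y^y_t$ is the scheme of the context built with $Z$. Then there exists $C\in\mathbb{R}_+$ such that $$\max_{0\le j\le n^l}\|Q_l^{[j]}f\|_{m,L}\le C\|f\|_{m,L},\qquad f\in\mathcal{C}^{m,L}_{\mathbf{pol}}(\mathbb{R}_+),\ l\in\mathbb{N}.$$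
   Context: $\mathbb{R}_+=[0,\infty)$. With $\psi_b(t)=\frac{1-e^{-bt}}{b}$ ($\psi_0(t)=t$), the scheme is $$\hat Y^y_t=e^{-bt/2}\Big(\sqrt{e^{-bt/2}y+\psi_b(t/2)(a-\tfrac{\sigma^2}{4})}+\tfrac{\sigma\sqrt t}{2}Z\Big)^2+\psi_b(t/2)\Big(a-\tfrac{\sigma^2}{4}\Big).$$ $Q^{[0]}=\mathrm{Id}$, $Q^{[j]}=Q^{[j-1]}Q$. For $m,L\in\mathbb{N}$, $\mathcal{C}^{m,L}_{\mathbf{pol}}(\mathbb{R}_+)$ is the space of $\mathcal{C}^m$ functions $f:\mathbb{R}_+\to\mathbb{R}$ with $\|f\|_{m,L}:=\max_{0\le j\le m}\sup_{y\ge0}\frac{|f^{(j)}(y)|}{1+y^L}<\infty$. For a density $\eta$ and $m\ge1$, $\eta^*_m(z)=(-1)^{m-1}\sum_{j=1}^mc_{j,m}z^j\eta^{(j)}(z)$, where $c_{1,1}=-1$ and for $m\ge2$, $1\le j\le m$, $$c_{j,m}=\Big(\frac{2j}{m-1}-4\Big)c_{j,m-1}\mathbf{1}_{j<m}+\frac{2}{m-1}c_{j-1,m-1}\mathbf{1}_{j>1}.$$ *)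

theory Defs
  imports "HOL-Probability.Probability" "HOL-Library.Landau_Symbols"
begin

definition psi :: "real \<Rightarrow> real \<Rightarrow> real" where
  "psi b t = (if b = 0 then t else (1 - exp (- b * t)) / b)"

definition Yhat :: "real \<Rightarrow> real \<Rightarrow> real \<Rightarrow> real \<Rightarrow> real \<Rightarrow> real \<Rightarrow> real" where
  "Yhat a b \<sigma> t y z =
     exp (- b * t / 2) *
       (sqrt (exp (- b * t / 2) * y + psi b (t / 2) * (a - \<sigma>\<^sup>2 / 4)) + \<sigma> * sqrt t / 2 * z)\<^sup>2
     + psi b (t / 2) * (a - \<sigma>\<^sup>2 / 4)"

definition Qop ::
  "'w measure \<Rightarrow> ('w \<Rightarrow> real) \<Rightarrow> real \<Rightarrow> real \<Rightarrow> real \<Rightarrow> real \<Rightarrow> (real \<Rightarrow> real) \<Rightarrow> real \<Rightarrow> real" where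
  "Qop P Z a b \<sigma> t f y = (\<integral>\<omega>. f (Yhat a b \<sigma> t y (Z \<omega>)) \<partial>P)"

text \<open>
  Derivatives are taken relative to a set \<open>S\<close>, so that a function on the half-line
  \<open>{0..}\<close> has a one-sided derivative at 0 and its values at negative arguments are
  irrelevant. For \<open>S = UNIV\<close> these are the ordinary derivatives on the real line.
\<close>

definition deriv_on :: "real set \<Rightarrow> nat \<Rightarrow> (real \<Rightarrow> real) \<Rightarrow> real \<Rightarrow> real" where
  "deriv_on S j f = ((\<lambda>g x. vector_derivative g (at x within S)) ^^ j) f"

definition Ck_on :: "nat \<Rightarrow> real set \<Rightarrow> (real \<Rightarrow> real) \<Rightarrow> bool" where
  "Ck_on k S f \<longleftrightarrow>
     (\<forall>j<k. deriv_on S j f differentiable_on S) \<and> (\<forall>j\<le>k. continuous_on S (deriv_on S j f))"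

definition Cpol :: "nat \<Rightarrow> nat \<Rightarrow> (real \<Rightarrow> real) set" where
  "Cpol m L = {f. Ck_on m {0..} f \<and>
     (\<forall>j\<le>m. bdd_above ((\<lambda>y. \<bar>deriv_on {0..} j f y\<bar> / (1 + y ^ L)) ` {0..}))}"

text \<open>The supremum is taken in the reals and is therefore only meaningful on \<open>Cpol m L\<close>.\<close>

definition pol_norm :: "nat \<Rightarrow> nat \<Rightarrow> (real \<Rightarrow> real) \<Rightarrow> real" where
  "pol_norm m L f =
     (MAX j\<in>{0..m}. SUP y\<in>{0..}. \<bar>deriv_on {0..} j f y\<bar> / (1 + y ^ L))"

text \<open>
  Coefficients \<open>c\<^sub>j\<^sub>,\<^sub>m\<close>, here \<open>c_coeff j m\<close>; only the values with \<open>1 \<le> j \<le> m\<close> are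
  meaningful. In the last equation \<open>m = k + 2\<close>, so \<open>m - 1 = k + 1\<close>.
\<close>

fun c_coeff :: "nat \<Rightarrow> nat \<Rightarrow> real" where
  "c_coeff j 0 = 0"
| "c_coeff j (Suc 0) = (if j = 1 then - 1 else 0)"
| "c_coeff j (Suc (Suc k)) =
     (if j < k + 2 then (2 * real j / real (k + 1) - 4) * c_coeff j (Suc k) else 0)
     + (if j > 1 then 2 / real (k + 1) * c_coeff (j - 1) (Suc k) else 0)"

definition eta_star :: "(real \<Rightarrow> real) \<Rightarrow> nat \<Rightarrow> real \<Rightarrow> real" where
  "eta_star \<eta> m z = (- 1) ^ (m - 1) * (\<Sum>j=1..m. c_coeff j m * z ^ j * deriv_on UNIV j \<eta> z)"

end

(*
  Write x = u^2 and s = sigma sqrt t / 2. Up to composition with affine maps, the scheme is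
  S f(x) = E f((u + s Z)^2). By symmetry eta z = rho (z^2), and the hypotheses on eta_star say
  that (-1)^k rho^(k) >= 0 for k <= M, so that eta is, for every k <= M, a mixture of the laws
  of one coordinate of a uniform point on a sphere of dimension 2 k. The k-th derivative of S f
  is then the average of f^(k) at the points x + s^2 R^2 + 2 s R u y, for a symmetric measure in
  y on [-1, 1] and a positive measure in R whose product has mass at most 1: differentiation
  raises the dimension by two, as for squared Bessel processes. Positivity reduces the bound on
  S to a moment computation, which gives a factor 1 + O(t) because y has mean zero. Iterating
  at most T / t times costs a constant factor.
*)

theory Submission
  imports Defs
begin

subsection \<open>Integrals with a parameter and one-sided derivatives\<close>

text \<open>Differentiating \<open>f (bessel_shift s x (R, y))\<close> in x produces the factor 1 +
  s R y / sqrt x, which is unbounded near x = 0 and of no use for estimates up to the boundary. Two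
  integrations by parts remove it. If the density is rho(z^2), put W_k(R) = (-2)^k R^(2k)
  rho^(k)(R^2), so that W_(k+1) = 2 k W_k - R W_k'. Integrating by parts in y passes from
  \<open>nu (Suc k)\<close> to \<open>nu k\<close>, and in R from W_(k+1) to W_k; together they show
  that the singular factor against W_k and \<open>nu k\<close> is the constant 1 against W_(k+1) and
  \<open>nu (Suc k)\<close>. Each step acts on a function whose last derivative is only continuous,
  so no second derivative may appear on the way. With n^l steps of length T / n^l, any fixed factor
  above 1 per step would be fatal. Hence the mass bound must be exactly 1, and the affine maps too
  are estimated by constants 1 + O(t). Decay of the weights at infinity comes from the moments of Z:
  by positivity, the boundary terms in R have the favourable sign.\<close>

lemma has_real_derivative_integral_dominated:
  fixes f f' :: "real \<Rightarrow> 'a \<Rightarrow> real"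
  assumes x: "x \<in> {c<..<d}"
    and int: "\<And>x. x \<in> {c<..<d} \<Longrightarrow> integrable M (f x)"
    and meas: "f' x \<in> borel_measurable M"
    and g: "integrable M g"
    and AE: "AE \<omega> in M. \<forall>x\<in>{c<..<d}.
      ((\<lambda>x. f x \<omega>) has_real_derivative f' x \<omega>) (at x) \<and> \<bar>f' x \<omega>\<bar> \<le> g \<omega>"
  shows "((\<lambda>x. \<integral>\<omega>. f x \<omega> \<partial>M) has_real_derivative (\<integral>\<omega>. f' x \<omega> \<partial>M)) (at x)"
proof -
  have "((\<lambda>y. ((\<integral>\<omega>. f y \<omega> \<partial>M) - (\<integral>\<omega>. f x \<omega> \<partial>M)) / (y - x)) \<longlongrightarrow> (\<integral>\<omega>. f' x \<omega> \<partial>M))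
      (at x within {c<..<d})"
    unfolding tendsto_at_iff_sequentially comp_def
  proof (intro allI impI)
    fix X :: "nat \<Rightarrow> real" assume X: "\<forall>i. X i \<in> {c<..<d} - {x}" and lim: "X \<longlonglongrightarrow> x"
    have Xi: "X i \<in> {c<..<d}" "X i \<noteq> x" for i using X by auto
    have "(\<lambda>i. \<integral>\<omega>. (f (X i) \<omega> - f x \<omega>) / (X i - x) \<partial>M) \<longlonglongrightarrow> (\<integral>\<omega>. f' x \<omega> \<partial>M)"
    proof (rule integral_dominated_convergence[where w = g])
      show "f' x \<in> borel_measurable M" "integrable M g" by fact+
      show "(\<lambda>\<omega>. (f (X i) \<omega> - f x \<omega>) / (X i - x)) \<in> borel_measurable M" for i
        using int[OF Xi(1)] int[OF x] by (auto intro!: borel_measurable_divide borel_measurable_diff)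
      show "AE \<omega> in M. (\<lambda>i. (f (X i) \<omega> - f x \<omega>) / (X i - x)) \<longlonglongrightarrow> f' x \<omega>"
        using AE
      proof eventually_elim
        case (elim \<omega>)
        then have "((\<lambda>x. f x \<omega>) has_real_derivative f' x \<omega>) (at x within {c<..<d})"
          using x by (auto intro: has_field_derivative_at_within)
        then show ?case
          using X lim unfolding has_field_derivative_iff tendsto_at_iff_sequentially comp_def by blast
      qed
      show "AE \<omega> in M. norm ((f (X i) \<omega> - f x \<omega>) / (X i - x)) \<le> g \<omega>" for i
        using AE
      proof eventually_elim
        case (elim \<omega>)
        have "norm (f (X i) \<omega> - f x \<omega>) \<le> g \<omega> * norm (X i - x)"
          by (rule field_differentiable_bound[of "{c<..<d}" "\<lambda>x. f x \<omega>" "\<lambda>x. f' x \<omega>"])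
            (use elim x Xi in \<open>auto intro: has_field_derivative_at_within\<close>)
        then show ?case
          using Xi(2)[of i] by (simp add: pos_divide_le_eq)
      qed
    qed
    moreover have "(\<integral>\<omega>. (f (X i) \<omega> - f x \<omega>) / (X i - x) \<partial>M)
        = ((\<integral>\<omega>. f (X i) \<omega> \<partial>M) - (\<integral>\<omega>. f x \<omega> \<partial>M)) / (X i - x)" for i
      using int[OF Xi(1)] int[OF x] by simp
    ultimately show "(\<lambda>i. ((\<integral>\<omega>. f (X i) \<omega> \<partial>M) - (\<integral>\<omega>. f x \<omega> \<partial>M)) / (X i - x))
        \<longlonglongrightarrow> (\<integral>\<omega>. f' x \<omega> \<partial>M)"
      by (simp only:)
  qed
  then show ?thesis
    using x by (simp add: has_field_derivative_iff at_within_open[OF x])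
qed

lemma continuous_on_integral_dominated:
  fixes f :: "real \<Rightarrow> 'a \<Rightarrow> real"
  assumes meas: "\<And>x. x \<in> S \<Longrightarrow> f x \<in> borel_measurable M"
    and g: "integrable M g"
    and AE: "AE \<omega> in M. continuous_on S (\<lambda>x. f x \<omega>) \<and> (\<forall>x\<in>S. \<bar>f x \<omega>\<bar> \<le> g \<omega>)"
  shows "continuous_on S (\<lambda>x. \<integral>\<omega>. f x \<omega> \<partial>M)"
  unfolding continuous_on_sequentially comp_def
proof (intro allI ballI impI)
  fix X x assume x: "x \<in> S" and X: "(\<forall>n. X n \<in> S) \<and> X \<longlonglongrightarrow> x"
  show "(\<lambda>n. \<integral>\<omega>. f (X n) \<omega> \<partial>M) \<longlonglongrightarrow> (\<integral>\<omega>. f x \<omega> \<partial>M)"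
  proof (rule integral_dominated_convergence[where w = g])
    show "AE \<omega> in M. (\<lambda>n. f (X n) \<omega>) \<longlonglongrightarrow> f x \<omega>"
      using AE by eventually_elim (use x X in \<open>auto simp: continuous_on_sequentially comp_def\<close>)
    show "AE \<omega> in M. norm (f (X n) \<omega>) \<le> g \<omega>" for n
      using AE by eventually_elim (use X in auto)
  qed (use meas g x X in auto)
qed

lemma continuous_on_atLeastI:
  fixes f :: "real \<Rightarrow> real"
  assumes "\<And>c. continuous_on {a..c} f"
  shows "continuous_on {a..} f"
  unfolding continuous_on_eq_continuous_within
proof
  fix x :: real assume x: "x \<in> {a..}"
  have "at x within {a..} = at x within {a..x + 1}"
    by (rule at_within_nhd[of x "{..<x + 1}"]) auto
  then show "continuous (at x within {a..}) f"
    using assms[of "x + 1"] x by (auto simp: continuous_on_eq_continuous_within)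
qed

text \<open>On \<open>{a..a + 1}\<close>, \<open>F\<close> is \<open>F a\<close> plus the integral
  of \<open>G\<close>, and \<open>G\<close> is continuous up to the endpoint. This supplies
  derivatives at 0, where \<open>sqrt\<close> is not differentiable and formulas are available in
  the interior only.\<close>

lemma has_real_derivative_within_atLeast:
  fixes F G :: "real \<Rightarrow> real"
  assumes F: "continuous_on {a..} F" and G: "continuous_on {a..} G"
    and deriv: "\<And>x. x > a \<Longrightarrow> (F has_real_derivative G x) (at x)"
    and x: "x \<ge> a"
  shows "(F has_real_derivative G x) (at x within {a..})"
proof (cases "x = a")
  case False
  then show ?thesis using deriv x by (auto intro: has_field_derivative_at_within)
next
  case True
  have "((\<lambda>u. integral {a..u} G) has_real_derivative G a) (at a within {a..a + 1})"
    by (rule integral_has_real_derivative) (auto intro: continuous_on_subset[OF G])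
  then have "((\<lambda>u. F a + integral {a..u} G) has_real_derivative G a) (at a within {a..a + 1})"
    by (auto intro!: derivative_eq_intros)
  moreover have "F a + integral {a..u} G = F u" if "u \<in> {a..a + 1}" for u
  proof -
    have "(G has_integral (F u - F a)) {a..u}"
      by (rule fundamental_theorem_of_calculus_interior)
        (use that deriv in \<open>auto intro!: continuous_on_subset[OF F]
           simp: has_real_derivative_iff_has_vector_derivative[symmetric]\<close>)
    then show ?thesis by (simp add: integral_unique)
  qed
  ultimately have "(F has_real_derivative G a) (at a within {a..a + 1})"
    using has_field_derivative_transform_within[of "\<lambda>u. F a + integral {a..u} G" "G a" a "{a..a + 1}" 1 F]
    by simp
  moreover have "at a within {a..} = at a within {a..a + 1}"
    by (rule at_within_nhd[of a "{..<a + 1}"]) auto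
  ultimately show ?thesis using True by simp
qed

lemma has_real_derivative_compose_within:
  fixes h w :: "real \<Rightarrow> real"
  assumes "(h has_real_derivative D) (at (w x) within T)" "(w has_real_derivative E) (at x within S)"
    "w ` S \<subseteq> T"
  shows "((\<lambda>x. h (w x)) has_real_derivative D * E) (at x within S)"
  using DERIV_image_chain[of h D w x S E] assms by (auto simp: comp_def intro: DERIV_subset)

text \<open>The factor tends to 1 with \<open>d\<close>, unlike the crude \<open>2 ^ L\<close>: a
  shift of size O(t) costs only 1 + O(t).\<close>

lemma power_add_le_weight:
  fixes y d :: real
  assumes "0 \<le> y" "0 \<le> d"
  shows "1 + (y + d) ^ L \<le> (1 + d) ^ L * (1 + y ^ L)"
proof (cases L)
  case (Suc k)
  have main: "(y + d) ^ Suc k \<le> (1 + d) ^ k * (y ^ Suc k + d)"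
  proof (induction k)
    case (Suc k)
    \<comment> \<open>\<open>y\<close> and \<open>y ^ Suc k\<close> lie on the same side of 1.
      Expanded, this is \<open>y + y ^ Suc k \<le> 1 + y ^ Suc (Suc k)\<close>.\<close>
    have "0 \<le> (1 - y) * (1 - y ^ Suc k)"
      using power_le_one[of y "Suc k"] one_le_power[of y "Suc k"] assms
      by (cases "y \<le> 1") (auto intro: mult_nonneg_nonneg mult_nonpos_nonpos simp del: power_Suc)
    then have "d * (y + y ^ Suc k) \<le> d * (1 + y ^ Suc (Suc k))"
      using assms by (intro mult_left_mono) (auto simp: algebra_simps)
    then have step: "(y + d) * (y ^ Suc k + d) \<le> (1 + d) * (y ^ Suc (Suc k) + d)"
      by (simp add: algebra_simps)
    have "(y + d) ^ Suc (Suc k) \<le> (y + d) * ((1 + d) ^ k * (y ^ Suc k + d))"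
      using Suc assms by (simp add: mult_left_mono)
    also have "\<dots> = (1 + d) ^ k * ((y + d) * (y ^ Suc k + d))" by (simp add: ac_simps)
    also have "\<dots> \<le> (1 + d) ^ k * ((1 + d) * (y ^ Suc (Suc k) + d))"
      using step assms by (intro mult_left_mono) auto
    finally show ?case by (simp add: ac_simps)
  qed (use assms in auto)
  have "1 \<le> (1 + d) ^ k" using assms by (simp add: one_le_power)
  moreover have "0 \<le> d * ((1 + d) ^ k * y ^ Suc k)" using assms by simp
  ultimately show ?thesis using main unfolding Suc by (simp add: algebra_simps)
qed auto

lemma finite_measure_if_integrable_one: "integrable M (\<lambda>_. 1 :: real) \<Longrightarrow> finite_measure M"
  by (rule finite_measureI) (simp add: integrable_iff_bounded)

lemma integrable_indicator_Icc:
  fixes f :: "real \<Rightarrow> real"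
  assumes "continuous_on {a..b} f"
  shows "integrable lborel (\<lambda>x. indicator {a..b} x * f x)"
  using borel_integrable_atLeastAtMost'[OF assms] by (simp add: set_integrable_def)

subsection \<open>Coordinates of uniform points on spheres\<close>

text \<open>
  Up to the factor \<open>|nu k|\<close>, \<open>nu k\<close> is the law of one coordinate of a uniform point
  of the unit sphere in dimension \<open>2 * k + 1\<close>.
\<close>

fun nu :: "nat \<Rightarrow> real measure" where
  "nu 0 = distr (count_space {- 1, 1}) borel (\<lambda>y. y)"
| "nu (Suc k) =
     density lborel (\<lambda>y. ennreal (indicator {- 1..1} y * ((1 - y\<^sup>2) ^ k / (2 ^ k * fact k))))"

declare nu.simps [simp del]

lemma sets_nu [simp, measurable_cong]: "sets (nu k) = sets borel"
  and space_nu [simp]: "space (nu k) = UNIV"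
  by (cases k; simp add: nu.simps)+

lemma nu_weight_nonneg:
  "0 \<le> indicator {- 1..1::real} y * ((1 - y\<^sup>2) ^ k / (2 ^ k * fact k))"
  by (auto simp: indicator_def abs_square_le_1 abs_le_iff intro!: divide_nonneg_nonneg zero_le_power)

lemma AE_nu: "AE y in nu k. \<bar>y\<bar> \<le> 1"
proof (cases k)
  case 0
  show ?thesis unfolding 0 nu.simps by (subst AE_distr_iff) (auto simp: AE_count_space)
next
  case (Suc j)
  show ?thesis unfolding Suc nu.simps by (subst AE_density) (auto simp: indicator_def)
qed

lemma nu_0_integrable:
  fixes f :: "real \<Rightarrow> real"
  assumes "f \<in> borel_measurable borel"
  shows "integrable (nu 0) f"
  using assms by (simp add: nu.simps integrable_distr_eq integrable_count_space)

lemma nu_0_integral: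
  fixes f :: "real \<Rightarrow> real"
  assumes "f \<in> borel_measurable borel"
  shows "(\<integral>y. f y \<partial>nu 0) = f 1 + f (- 1)"
  using assms by (simp add: nu.simps integral_distr lebesgue_integral_count_space_finite)

lemma nu_Suc_integral:
  fixes f :: "real \<Rightarrow> real"
  assumes "f \<in> borel_measurable borel"
  shows "(\<integral>y. f y \<partial>nu (Suc k)) =
    (\<integral>y. indicator {- 1..1} y * ((1 - y\<^sup>2) ^ k / (2 ^ k * fact k) * f y) \<partial>lborel)"
  using assms nu_weight_nonneg by (simp add: nu.simps integral_real_density mult.assoc)

lemma finite_measure_nu: "finite_measure (nu k)"
proof (cases k)
  case 0
  have "integrable (nu 0) (\<lambda>_. 1 :: real)" by (rule nu_0_integrable) simp
  then show ?thesis unfolding 0 by (rule finite_measure_if_integrable_one)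
next
  case (Suc j)
  have "integrable lborel (\<lambda>y. indicator {- 1..1} y * ((1 - y\<^sup>2) ^ j / (2 ^ j * fact j)) :: real)"
    by (intro integrable_indicator_Icc continuous_intros) simp
  then have "integrable (nu (Suc j)) (\<lambda>_. 1 :: real)"
    using nu_weight_nonneg by (simp add: nu.simps integrable_real_density)
  then show ?thesis unfolding Suc by (rule finite_measure_if_integrable_one)
qed

lemma nu_integrable:
  fixes f :: "real \<Rightarrow> real"
  assumes "continuous_on UNIV f"
  shows "integrable (nu k) f"
proof -
  interpret finite_measure "nu k" by (rule finite_measure_nu)
  have "compact (f ` {- 1..1})"
    by (rule compact_continuous_image) (use assms continuous_on_subset in auto)
  then obtain B where B: "\<And>y. y \<in> {- 1..1} \<Longrightarrow> \<bar>f y\<bar> \<le> B"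
    by (force dest!: compact_imp_bounded simp: bounded_iff)
  have [measurable]: "f \<in> borel_measurable borel"
    using assms by (rule borel_measurable_continuous_onI)
  show ?thesis
  proof (rule integrable_const_bound[where B = B])
    show "AE y in nu k. norm (f y) \<le> B"
      using AE_nu by eventually_elim (auto intro!: B)
  qed simp
qed

text \<open>If w_k is the density of \<open>nu (Suc k)\<close>, the normalisation
  \<open>2 ^ k * fact k\<close> gives w_(k+1)' = - y w_k with no constant left. For
  \<open>k > 0\<close> the weight vanishes at both ends of the interval; for \<open>k = 0\<close> it
  is constant, and the boundary terms are the integral against \<open>nu 0\<close>.\<close>

lemma nu_by_parts:
  fixes \<phi> \<phi>' :: "real \<Rightarrow> real"
  assumes cont: "continuous_on UNIV \<phi>" "continuous_on UNIV \<phi>'"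
    and deriv: "\<And>y. y \<in> {- 1..1} \<Longrightarrow> (\<phi> has_real_derivative \<phi>' y) (at y within {- 1..1})"
  shows "(\<integral>y. \<phi>' y \<partial>nu (Suc k)) = (\<integral>y. \<phi> y * y \<partial>nu k)"
proof -
  have m [measurable]: "\<phi> \<in> borel_measurable borel" "\<phi>' \<in> borel_measurable borel"
    using cont by (auto intro: borel_measurable_continuous_onI)
  have cont': "continuous_on A \<phi>" "continuous_on A \<phi>'" for A
    using cont continuous_on_subset by blast+
  show ?thesis
  proof (cases k)
    case 0
    have "(\<integral>y. indicator {- 1..1} y *\<^sub>R \<phi>' y \<partial>lborel) = \<phi> 1 - \<phi> (- 1)"
      by (rule integral_FTC_Icc) (use deriv cont' in \<open>auto simp: has_real_derivative_iff_has_vector_derivative\<close>)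
    then show ?thesis
      unfolding 0 by (subst nu_Suc_integral; simp add: nu_0_integral)
  next
    case (Suc j)
    define w where "w k y = (1 - y\<^sup>2) ^ k / (2 ^ k * fact k)" for k and y :: real
    have w': "(w (Suc j) has_real_derivative - y * w j y) (at y within {- 1..1})" for y
    proof -
      have "(w (Suc j) has_real_derivative
          real (Suc j) * ((1 - y\<^sup>2) ^ j * (- 2 * y)) / (2 ^ Suc j * fact (Suc j))) (at y within {- 1..1})"
        unfolding w_def by (auto intro!: derivative_eq_intros simp del: power_Suc)
      also have "real (Suc j) * ((1 - y\<^sup>2) ^ j * (- 2 * y)) / (2 ^ Suc j * fact (Suc j)) = - y * w j y"
        by (simp add: w_def del: of_nat_Suc)
      finally show ?thesis .
    qed
    have cw: "continuous_on A (w k)" for A k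
      unfolding w_def by (intro continuous_intros) auto
    have w1: "w (Suc j) 1 = 0" "w (Suc j) (- 1) = 0" by (simp_all add: w_def)
    have "(\<integral>y. indicator {- 1..1} y *\<^sub>R (w (Suc j) y * \<phi>' y - w j y * (\<phi> y * y)) \<partial>lborel)
        = w (Suc j) 1 * \<phi> 1 - w (Suc j) (- 1) * \<phi> (- 1)"
      by (rule integral_FTC_Icc)
        (use deriv in \<open>auto intro!: continuous_intros cont' cw derivative_eq_intros w'
           simp: has_real_derivative_iff_has_vector_derivative[symmetric]\<close>)
    then have "(\<integral>y. indicator {- 1..1} y * (w (Suc j) y * \<phi>' y)
        - indicator {- 1..1} y * (w j y * (\<phi> y * y)) \<partial>lborel) = 0"
      by (simp add: w1 algebra_simps)
    moreover have "integrable lborel (\<lambda>y. indicator {- 1..1} y * (w (Suc j) y * \<phi>' y))"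
      by (intro integrable_indicator_Icc continuous_intros cont' cw)
    moreover have "integrable lborel (\<lambda>y. indicator {- 1..1} y * (w j y * (\<phi> y * y)))"
      by (intro integrable_indicator_Icc continuous_intros cont' cw)
    ultimately have "(\<integral>y. indicator {- 1..1} y * (w (Suc j) y * \<phi>' y) \<partial>lborel)
        = (\<integral>y. indicator {- 1..1} y * (w j y * (\<phi> y * y)) \<partial>lborel)"
      by simp
    then show ?thesis
      unfolding Suc by (subst (1 2) nu_Suc_integral) (simp_all add: w_def)
  qed
qed

text \<open>For \<open>k > 0\<close> the two densities differ by the factor (1 - y^2) / (2 k). For
  \<open>k = 0\<close> both sides vanish, since \<open>nu 0\<close> lives on the points -1 and
  1.\<close>

lemma nu_weight:
  fixes f :: "real \<Rightarrow> real"
  assumes [measurable]: "f \<in> borel_measurable borel"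
  shows "2 * real k * (\<integral>y. f y \<partial>nu (Suc k)) = (\<integral>y. (1 - y\<^sup>2) * f y \<partial>nu k)"
proof (cases k)
  case 0
  then show ?thesis by (simp add: nu_0_integral)
next
  case (Suc j)
  have "2 * real (Suc j) * (\<integral>y. f y \<partial>nu (Suc (Suc j))) =
     (\<integral>y. 2 * real (Suc j) *
       (indicator {- 1..1} y * ((1 - y\<^sup>2) ^ Suc j / (2 ^ Suc j * fact (Suc j)) * f y)) \<partial>lborel)"
    by (subst nu_Suc_integral) simp_all
  also have "\<dots> = (\<integral>y. indicator {- 1..1} y * ((1 - y\<^sup>2) ^ j / (2 ^ j * fact j) * ((1 - y\<^sup>2) * f y)) \<partial>lborel)"
    by (intro Bochner_Integration.integral_cong refl) (simp del: of_nat_Suc)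
  finally show ?thesis
    unfolding Suc by (subst (2) nu_Suc_integral) simp_all
qed

lemma nu_mean_zero: "(\<integral>y. y \<partial>nu k) = 0"
  using nu_by_parts[of "\<lambda>_. 1" "\<lambda>_. 0" k] by simp

text \<open>Add \<open>nu_by_parts\<close> for the identity function and \<open>nu_weight\<close>
  for the constant 1: y^2 and 1 - y^2 sum to 1.\<close>

lemma nu_mass: "(2 * k + 1) * measure (nu (Suc k)) UNIV = measure (nu k) UNIV"
proof -
  have int: "integrable (nu k) (\<lambda>y. y\<^sup>2)" "integrable (nu k) (\<lambda>y. 1 :: real)"
    by (auto intro!: nu_integrable continuous_intros)
  have "(\<integral>y. 1 \<partial>nu (Suc k)) = (\<integral>y. y * y \<partial>nu k)"
    by (rule nu_by_parts) (auto intro!: derivative_eq_intros)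
  moreover have "2 * real k * (\<integral>y. 1 \<partial>nu (Suc k)) = (\<integral>y. 1 - y\<^sup>2 \<partial>nu k)"
    using nu_weight[of "\<lambda>_. 1" k] by simp
  ultimately show ?thesis
    using int by (simp add: power2_eq_square algebra_simps)
qed

subsection \<open>Radial weights\<close>

lemma tendsto_integral_indicator_Icc:
  fixes f :: "real \<Rightarrow> real"
  assumes int: "integrable lborel (\<lambda>x. indicator {0..} x * f x)"
  shows "(\<lambda>n. \<integral>x. indicator {0..real n} x * f x \<partial>lborel) \<longlonglongrightarrow>
    (\<integral>x. indicator {0..} x * f x \<partial>lborel)"
proof (rule integral_dominated_convergence[where w = "\<lambda>x. \<bar>indicator {0..} x * f x\<bar>"])
  have eq: "indicator {0..real n} x * f x = indicator {..real n} x * (indicator {0..} x * f x)" for n x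
    by (auto simp: indicator_def)
  show "(\<lambda>x. indicator {0..real n} x * f x) \<in> borel_measurable lborel" for n
    unfolding eq by (rule borel_measurable_times[OF _ borel_measurable_integrable[OF int]]) simp
  show "AE x in lborel. (\<lambda>n. indicator {0..real n} x * f x) \<longlonglongrightarrow> indicator {0..} x * f x"
  proof (intro AE_I2)
    fix x :: real
    have "eventually (\<lambda>n. real n \<ge> x) sequentially"
      by (meson eventually_sequentiallyI nat_ceiling_le_eq)
    then show "(\<lambda>n. indicator {0..real n} x * f x) \<longlonglongrightarrow> indicator {0..} x * f x"
      by (intro tendsto_eventually) (auto elim!: eventually_mono simp: indicator_def)
  qed
qed (use int in \<open>auto simp: indicator_def\<close>)

text \<open>The model is W_k(R) = (-2)^k R^(2k) rho^(k)(R^2) with \<open>W 0 R\<close> = rho(R^2);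
  the recursion then says W_(k+1) = - R^(2k+1) (R^(-2k) W_k)'. Moments are assumed for
  \<open>W 0\<close> only and propagate to the others by positivity. The mass 1/2 compensates the
  mass 2 of \<open>nu 0\<close>.\<close>

locale radial_weights =
  fixes W :: "nat \<Rightarrow> real \<Rightarrow> real" and m :: nat
  assumes W_cont: "k \<le> m \<Longrightarrow> continuous_on UNIV (W k)"
    and W_deriv: "k < m \<Longrightarrow>
      \<exists>D. (W k has_real_derivative D) (at R) \<and> W (Suc k) R = 2 * real k * W k R - R * D"
    and W_nonneg: "k \<le> m \<Longrightarrow> 0 \<le> R \<Longrightarrow> 0 \<le> W k R"
    and W0_moments: "integrable lborel (\<lambda>R. indicator {0..} R * (W 0 R * R ^ j))"
    and W0_mass: "(\<integral>R. indicator {0..} R * W 0 R \<partial>lborel) = 1 / 2"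
begin

lemma W_measurable [measurable]: "k \<le> m \<Longrightarrow> W k \<in> borel_measurable borel"
  using W_cont by (rule borel_measurable_continuous_onI)

text \<open>The derivative required is that of \<open>R * B R\<close>, not of \<open>B\<close>: in
  the application \<open>B\<close> is a mean of a merely continuous function, and the factor
  \<open>R\<close> is what makes the product differentiable.\<close>

lemma W_by_parts:
  assumes k: "k < m" and N: "0 \<le> N"
    and B: "continuous_on {0..} B" and A: "continuous_on {0..} A"
    and deriv: "\<And>R. R \<ge> 0 \<Longrightarrow> ((\<lambda>R. R * B R) has_real_derivative A R) (at R within {0..})"
  shows "(\<integral>R. indicator {0..N} R * (W (Suc k) R * B R) \<partial>lborel) =
    (\<integral>R. indicator {0..N} R * (W k R * (2 * real k * B R + A R)) \<partial>lborel) - W k N * (N * B N)"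
proof -
  have c: "continuous_on {0..N} (W k)" "continuous_on {0..N} (W (Suc k))"
    "continuous_on {0..N} A" "continuous_on {0..N} B"
    using k by (auto intro: continuous_on_subset[OF W_cont] continuous_on_subset[OF A] continuous_on_subset[OF B])
  have "(\<integral>R. indicator {0..N} R *\<^sub>R (W k R * (2 * real k * B R + A R) - W (Suc k) R * B R) \<partial>lborel)
      = W k N * (N * B N) - W k 0 * (0 * B 0)"
  proof (rule integral_FTC_Icc)
    fix R assume R: "0 \<le> R" "R \<le> N"
    obtain D where D: "(W k has_real_derivative D) (at R)" "W (Suc k) R = 2 * real k * W k R - R * D"
      using W_deriv[OF k, of R] by auto
    have "((\<lambda>R. W k R * (R * B R)) has_real_derivative D * (R * B R) + A R * W k R) (at R within {0..N})"
      by (rule DERIV_mult[OF has_field_derivative_at_within[OF D(1)] DERIV_subset[OF deriv[OF R(1)]]]) simp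
    also have "D * (R * B R) + A R * W k R = W k R * (2 * real k * B R + A R) - W (Suc k) R * B R"
      unfolding D(2) by (simp add: algebra_simps)
    finally show "((\<lambda>R. W k R * (R * B R)) has_vector_derivative
        W k R * (2 * real k * B R + A R) - W (Suc k) R * B R) (at R within {0..N})"
      by (simp add: has_real_derivative_iff_has_vector_derivative)
  qed (use N c in \<open>auto intro!: continuous_intros\<close>)
  moreover have "integrable lborel (\<lambda>R. indicator {0..N} R * (W k R * (2 * real k * B R + A R)))"
    "integrable lborel (\<lambda>R. indicator {0..N} R * (W (Suc k) R * B R))"
    by (intro integrable_indicator_Icc continuous_intros c)+
  ultimately show ?thesis by (simp add: right_diff_distrib)
qed

lemma W_step:
  assumes "k < m" "0 \<le> N"
  shows "(\<integral>R. indicator {0..N} R * (W (Suc k) R * R ^ j) \<partial>lborel) =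
    real (Suc (2 * k + j)) * (\<integral>R. indicator {0..N} R * (W k R * R ^ j) \<partial>lborel) - W k N * N ^ Suc j"
proof -
  have d: "((\<lambda>R. R * R ^ j) has_real_derivative real (Suc j) * R ^ j) (at R within {0..})" for R
    using DERIV_power[OF DERIV_ident, of "Suc j" R "{0..}"] by simp
  have "(\<integral>R. indicator {0..N} R * (W (Suc k) R * R ^ j) \<partial>lborel) =
    (\<integral>R. indicator {0..N} R * (W k R * (2 * real k * R ^ j + Suc j * R ^ j)) \<partial>lborel) - W k N * (N * N ^ j)"
    by (intro W_by_parts[where B = "\<lambda>R. R ^ j" and A = "\<lambda>R. real (Suc j) * R ^ j"] assms d
        continuous_intros)
  also have "(\<integral>R. indicator {0..N} R * (W k R * (2 * real k * R ^ j + Suc j * R ^ j)) \<partial>lborel) =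
      (\<integral>R. real (Suc (2 * k + j)) * (indicator {0..N} R * (W k R * R ^ j)) \<partial>lborel)"
    by (intro Bochner_Integration.integral_cong) (auto simp: algebra_simps)
  finally show ?thesis by simp
qed

lemma W_integral_Icc_le:
  assumes "k \<le> m" and "integrable lborel (\<lambda>R. indicator {0..} R * (W k R * R ^ j))"
  shows "(\<integral>R. indicator {0..N} R * (W k R * R ^ j) \<partial>lborel) \<le>
    (\<integral>R. indicator {0..} R * (W k R * R ^ j) \<partial>lborel)"
proof (rule integral_mono)
  show "integrable lborel (\<lambda>R. indicator {0..N} R * (W k R * R ^ j))"
    by (intro integrable_indicator_Icc continuous_intros continuous_on_subset[OF W_cont[OF assms(1)]]) simp
  show "indicator {0..N} R * (W k R * R ^ j) \<le> indicator {0..} R * (W k R * R ^ j)" for R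
    using W_nonneg[OF assms(1)] by (auto simp: indicator_def)
qed fact

text \<open>The boundary term in \<open>W_step\<close> is subtracted and nonnegative, so the
  truncated moments of the next weight are bounded by a full moment of the present one. Monotone
  convergence then gives integrability and the inequality at once.\<close>

lemma W_moments_aux:
  assumes "k \<le> m"
  shows "integrable lborel (\<lambda>R. indicator {0..} R * (W k R * R ^ j)) \<and>
    (0 < k \<longrightarrow> (\<integral>R. indicator {0..} R * (W k R * R ^ j) \<partial>lborel) \<le>
      real (Suc (2 * (k - 1) + j)) * (\<integral>R. indicator {0..} R * (W (k - 1) R * R ^ j) \<partial>lborel))"
  using assms
proof (induction k)
  case 0
  then show ?case using W0_moments by simp
next
  case (Suc k)
  define f where "f n R = indicator {0..real n} R * (W (Suc k) R * R ^ j)" for n R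
  let ?c = "real (Suc (2 * k + j)) * (\<integral>R. indicator {0..} R * (W k R * R ^ j) \<partial>lborel)"
  have IH: "integrable lborel (\<lambda>R. indicator {0..} R * (W k R * R ^ j))"
    using Suc by simp
  have le: "(\<integral>R. f n R \<partial>lborel) \<le> ?c" for n
  proof -
    have "(\<integral>R. f n R \<partial>lborel) \<le> real (Suc (2 * k + j)) * (\<integral>R. indicator {0..real n} R * (W k R * R ^ j) \<partial>lborel)"
      unfolding f_def using Suc.prems W_nonneg[of k "real n"] by (subst W_step) auto
    also have "\<dots> \<le> ?c"
      using Suc.prems IH by (intro mult_left_mono W_integral_Icc_le) auto
    finally show ?thesis .
  qed
  have int: "integrable lborel (f n)" for n
    unfolding f_def
    by (intro integrable_indicator_Icc continuous_intros continuous_on_subset[OF W_cont[OF Suc.prems]]) simp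
  have mono: "f n R \<le> f n' R" if "n \<le> n'" for n n' R
    using W_nonneg[OF Suc.prems] that by (auto simp: f_def indicator_def)
  have "incseq (\<lambda>n. \<integral>R. f n R \<partial>lborel)"
    using int mono by (intro monoI integral_mono) auto
  then obtain l where l: "(\<lambda>n. \<integral>R. f n R \<partial>lborel) \<longlonglongrightarrow> l"
    using le incseq_convergent by blast
  have "integrable lborel (\<lambda>R. indicator {0..} R * (W (Suc k) R * R ^ j))"
  proof (rule integrable_monotone_convergence[OF int _ _ l])
    show "AE R in lborel. mono (\<lambda>n. f n R)"
      using mono by (auto intro!: monoI)
    show "AE R in lborel. (\<lambda>n. f n R) \<longlonglongrightarrow> indicator {0..} R * (W (Suc k) R * R ^ j)"
    proof (intro AE_I2)
      fix R :: real
      have "eventually (\<lambda>n. real n \<ge> R) sequentially"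
        by (meson eventually_sequentiallyI nat_ceiling_le_eq)
      then show "(\<lambda>n. f n R) \<longlonglongrightarrow> indicator {0..} R * (W (Suc k) R * R ^ j)"
        unfolding f_def by (intro tendsto_eventually) (auto elim!: eventually_mono simp: indicator_def)
    qed
    show "(\<lambda>R. indicator {0..} R * (W (Suc k) R * R ^ j)) \<in> borel_measurable lborel"
      using Suc.prems by measurable
  qed
  moreover from tendsto_integral_indicator_Icc[OF this]
  have "(\<integral>R. indicator {0..} R * (W (Suc k) R * R ^ j) \<partial>lborel) \<le> ?c"
    by (rule LIMSEQ_le_const2) (use le in \<open>auto simp: f_def\<close>)
  ultimately show ?case by simp
qed

lemma W_moments: "k \<le> m \<Longrightarrow> integrable lborel (\<lambda>R. indicator {0..} R * (W k R * R ^ j))"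
  using W_moments_aux by blast

text \<open>The truncated moment of \<open>W (Suc k)\<close> is nonnegative, so the boundary term in
  \<open>W_step\<close> cannot exceed the term it is subtracted from. As \<open>j\<close> is
  arbitrary, \<open>W k\<close> decays faster than every power.\<close>

lemma W_decay:
  assumes "k < m" "0 \<le> N"
  shows "W k N * N ^ Suc j \<le> real (Suc (2 * k + j)) * (\<integral>R. indicator {0..} R * (W k R * R ^ j) \<partial>lborel)"
proof -
  have "0 \<le> (\<integral>R. indicator {0..N} R * (W (Suc k) R * R ^ j) \<partial>lborel)"
    using assms W_nonneg[of "Suc k"] by (intro integral_nonneg_AE) (auto simp: indicator_def)
  then have "W k N * N ^ Suc j \<le> real (Suc (2 * k + j)) * (\<integral>R. indicator {0..N} R * (W k R * R ^ j) \<partial>lborel)"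
    using W_step[OF assms, of j] by simp
  also have "\<dots> \<le> real (Suc (2 * k + j)) * (\<integral>R. indicator {0..} R * (W k R * R ^ j) \<partial>lborel)"
    using assms by (intro mult_left_mono W_integral_Icc_le W_moments) auto
  finally show ?thesis .
qed

section \<open>Product measures in radius and coordinate: integrability and mass\<close>

definition rad :: "nat \<Rightarrow> real measure" where
  "rad k = density lborel (\<lambda>R. ennreal (indicator {0..} R * W k R))"

definition mu :: "nat \<Rightarrow> (real \<times> real) measure" where
  "mu k = rad k \<Otimes>\<^sub>M nu k"

lemma sets_rad [simp, measurable_cong]: "sets (rad k) = sets borel"
  and space_rad [simp]: "space (rad k) = UNIV"
  by (simp_all add: rad_def)

lemma sets_mu [simp, measurable_cong]: "sets (mu k) = sets (borel \<Otimes>\<^sub>M borel)"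
  unfolding mu_def by (rule sets_pair_measure_cong) simp_all

lemma space_mu [simp]: "space (mu k) = UNIV"
  by (simp add: mu_def space_pair_measure)

lemma rad_integrable:
  fixes f :: "real \<Rightarrow> real"
  assumes "k \<le> m" "f \<in> borel_measurable borel"
  shows "integrable (rad k) f \<longleftrightarrow> integrable lborel (\<lambda>R. indicator {0..} R * (W k R * f R))"
  unfolding rad_def using assms W_nonneg
  by (subst integrable_real_density) (auto simp: mult.assoc indicator_def)

lemma rad_integral:
  fixes f :: "real \<Rightarrow> real"
  assumes "k \<le> m" "f \<in> borel_measurable borel"
  shows "(\<integral>R. f R \<partial>rad k) = (\<integral>R. indicator {0..} R * (W k R * f R) \<partial>lborel)"
  unfolding rad_def using assms W_nonneg
  by (subst integral_real_density) (auto simp: mult.assoc indicator_def)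

lemma finite_measure_rad: "k \<le> m \<Longrightarrow> finite_measure (rad k)"
  using W_moments[of k 0] by (intro finite_measure_if_integrable_one) (simp add: rad_integrable)

lemma pair_rad_nu: "k \<le> m \<Longrightarrow> pair_sigma_finite (rad k) (nu k)"
  using finite_measure_rad finite_measure_nu
  by (intro pair_sigma_finite.intro finite_measure.axioms(1))

lemma finite_measure_mu: "k \<le> m \<Longrightarrow> finite_measure (mu k)"
  unfolding mu_def using finite_measure_rad finite_measure_nu
  by (intro finite_measure_pair_measure)

lemma AE_rad: "k \<le> m \<Longrightarrow> AE R in rad k. 0 \<le> R"
  unfolding rad_def by (subst AE_density) (auto simp: indicator_def)

lemma AE_mu:
  assumes "k \<le> m"
  shows "AE p in mu k. 0 \<le> fst p \<and> \<bar>snd p\<bar> \<le> 1"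
proof -
  interpret pair_sigma_finite "rad k" "nu k" by (rule pair_rad_nu[OF assms])
  show ?thesis unfolding mu_def
  proof (rule AE_pair_measure)
    show "{p \<in> space (rad k \<Otimes>\<^sub>M nu k). 0 \<le> fst p \<and> \<bar>snd p\<bar> \<le> 1} \<in> sets (rad k \<Otimes>\<^sub>M nu k)"
      by measurable
    show "AE R in rad k. AE y in nu k. 0 \<le> fst (R, y) \<and> \<bar>snd (R, y)\<bar> \<le> 1"
      using AE_rad[OF assms] AE_nu[of k] by auto
  qed
qed

lemma mu_moments:
  assumes "k \<le> m"
  shows "integrable (mu k) (\<lambda>p. (1 + fst p) ^ n)"
proof -
  interpret pair_sigma_finite "rad k" "nu k" by (rule pair_rad_nu[OF assms])
  interpret N: finite_measure "nu k" by (rule finite_measure_nu)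
  have "integrable (rad k) (\<lambda>R. R ^ j)" for j
    using W_moments[OF assms] by (subst rad_integrable[OF assms]) auto
  then have int: "integrable (rad k) (\<lambda>R. (1 + R) ^ n)"
    by (simp add: binomial_ring)
  show ?thesis unfolding mu_def
  proof (rule Fubini_integrable)
    show "integrable (rad k) (\<lambda>R. \<integral>y. norm ((1 + fst (R, y)) ^ n) \<partial>nu k)"
      using integrable_norm[OF int] by simp
  qed (auto simp: measurable_split_conv)
qed

lemma mu_integral:
  fixes f :: "real \<times> real \<Rightarrow> real"
  assumes "k \<le> m" "integrable (mu k) f"
  shows "(\<integral>p. f p \<partial>mu k) = (\<integral>R. (\<integral>y. f (R, y) \<partial>nu k) \<partial>rad k)"
proof -
  interpret pair_sigma_finite "rad k" "nu k" by (rule pair_rad_nu[OF assms(1)])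
  show ?thesis using integral_fst'[of f] assms(2) by (simp add: mu_def)
qed

lemma mu_mass_eq:
  assumes "k \<le> m"
  shows "measure (mu k) UNIV = (\<integral>R. indicator {0..} R * W k R \<partial>lborel) * measure (nu k) UNIV"
proof -
  interpret finite_measure "mu k" by (rule finite_measure_mu[OF assms])
  have "measure (mu k) UNIV = (\<integral>p. 1 \<partial>mu k)" by simp
  also have "\<dots> = (\<integral>R. (\<integral>y. 1 \<partial>nu k) \<partial>rad k)"
    using assms by (subst mu_integral) auto
  finally show ?thesis
    using rad_integral[OF assms, of "\<lambda>_. 1"] by (simp add: mult.commute)
qed

text \<open>From \<open>k\<close> to \<open>Suc k\<close> the radial integral grows at most by the
  factor 2 k + 1, and the mass of \<open>nu\<close> shrinks by exactly this factor. The start is 2 *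
  1/2 = 1.\<close>

lemma mu_mass_le:
  assumes "k \<le> m"
  shows "measure (mu k) UNIV \<le> 1"
  using assms
proof (induction k)
  case 0
  have "measure (nu 0) UNIV = 2" using nu_0_integral[of "\<lambda>_. 1"] by simp
  then show ?case using mu_mass_eq[of 0] W0_mass by simp
next
  case (Suc k)
  have "(\<integral>R. indicator {0..} R * W (Suc k) R \<partial>lborel)
      \<le> real (Suc (2 * k)) * (\<integral>R. indicator {0..} R * W k R \<partial>lborel)"
    using W_moments_aux[OF Suc.prems, of 0] by simp
  then have "measure (mu (Suc k)) UNIV
      \<le> real (Suc (2 * k)) * (\<integral>R. indicator {0..} R * W k R \<partial>lborel) * measure (nu (Suc k)) UNIV"
    using Suc.prems by (subst mu_mass_eq) (auto intro!: mult_right_mono)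
  also have "\<dots> = measure (mu k) UNIV"
    using Suc.prems nu_mass[of k] by (subst mu_mass_eq) (auto simp: ac_simps)
  also have "\<dots> \<le> 1" using Suc by simp
  finally show ?case .
qed

end

subsection \<open>The averaging operators\<close>

text \<open>For \<open>p = (R, y)\<close> this is the squared Euclidean norm of sqrt x * e + s * R *
  v, where e and v are unit vectors with inner product y.\<close>

definition bessel_shift :: "real \<Rightarrow> real \<Rightarrow> real \<times> real \<Rightarrow> real" where
  "bessel_shift s x p = x + (s * fst p)\<^sup>2 + 2 * s * fst p * sqrt x * snd p"

lemma bessel_shift_nonneg:
  assumes "0 \<le> x" "\<bar>snd p\<bar> \<le> 1"
  shows "0 \<le> bessel_shift s x p"
proof -
  \<comment> \<open>The squared components along e and orthogonal to e.\<close>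
  have "bessel_shift s x p = (sqrt x + s * fst p * snd p)\<^sup>2 + (s * fst p)\<^sup>2 * (1 - (snd p)\<^sup>2)"
    using assms by (simp add: bessel_shift_def power2_eq_square algebra_simps)
  then show ?thesis using assms by (simp add: abs_square_le_1)
qed

lemma bessel_shift_le:
  assumes "0 \<le> s" "0 \<le> x" "x \<le> c" "0 \<le> fst p" "\<bar>snd p\<bar> \<le> 1"
  shows "bessel_shift s x p \<le> ((sqrt c + s) * (1 + fst p))\<^sup>2"
proof -
  have "s * fst p * sqrt x * snd p \<le> s * fst p * sqrt x * 1"
    using assms by (intro mult_left_mono) auto
  then have "bessel_shift s x p \<le> (sqrt x + s * fst p)\<^sup>2"
    using assms by (simp add: bessel_shift_def power2_eq_square algebra_simps)
  also have "\<dots> \<le> ((sqrt c + s) * (1 + fst p))\<^sup>2"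
  proof (rule power_mono)
    have "sqrt x \<le> sqrt c" "0 \<le> sqrt c * fst p" using assms by auto
    then have "sqrt x + s * fst p \<le> sqrt c + s * fst p + (s + sqrt c * fst p)"
      using \<open>0 \<le> s\<close> by linarith
    then show "sqrt x + s * fst p \<le> (sqrt c + s) * (1 + fst p)"
      by (simp add: algebra_simps)
  qed (use assms in auto)
  finally show ?thesis .
qed

lemma growth_const_nonneg:
  fixes h :: "real \<Rightarrow> real"
  assumes "\<And>w. 0 \<le> w \<Longrightarrow> \<bar>h w\<bar> \<le> H * (1 + w ^ L)"
  shows "0 \<le> H"
  using order_trans[OF abs_ge_zero assms[of 1]] by simp

text \<open>A bound uniform in \<open>x\<close> up to \<open>c\<close> and integrable by
  \<open>mu_moments\<close>: the dominating function for continuity and differentiation in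
  \<open>x\<close>.\<close>

lemma abs_shift_le:
  fixes h :: "real \<Rightarrow> real"
  assumes h: "\<And>w. 0 \<le> w \<Longrightarrow> \<bar>h w\<bar> \<le> H * (1 + w ^ L)"
    and "0 \<le> s" "0 \<le> x" "x \<le> c" "0 \<le> fst p" "\<bar>snd p\<bar> \<le> 1"
  shows "\<bar>h (bessel_shift s x p)\<bar> \<le> H * (1 + (sqrt c + s) ^ (2 * L)) * (1 + fst p) ^ (2 * L)"
proof -
  have H: "0 \<le> H" using h by (rule growth_const_nonneg)
  have nn: "0 \<le> bessel_shift s x p" using bessel_shift_nonneg assms by simp
  have "bessel_shift s x p ^ L \<le> (((sqrt c + s) * (1 + fst p))\<^sup>2) ^ L"
    using nn bessel_shift_le[of s x c p] assms by (intro power_mono) auto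
  also have "\<dots> = (sqrt c + s) ^ (2 * L) * (1 + fst p) ^ (2 * L)"
    by (simp add: power_mult[symmetric] power_mult_distrib)
  finally have "1 + bessel_shift s x p ^ L \<le> (1 + (sqrt c + s) ^ (2 * L)) * (1 + fst p) ^ (2 * L)"
    using one_le_power[of "1 + fst p" "2 * L"] \<open>0 \<le> fst p\<close> unfolding distrib_right
    by linarith
  then show ?thesis
    using h[OF nn] H by (simp add: mult.assoc order_trans[OF _ mult_left_mono])
qed

lemma continuous_on_shift [continuous_intros]:
  fixes f g :: "'a::topological_space \<Rightarrow> real"
  assumes "continuous_on A f" "continuous_on A r" "continuous_on A y"
  shows "continuous_on A (\<lambda>z. bessel_shift s (f z) (r z, y z))"
  using assms unfolding bessel_shift_def by (auto intro!: continuous_intros)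

lemma borel_measurable_shift [measurable]: "bessel_shift s x \<in> borel_measurable (borel \<Otimes>\<^sub>M borel)"
  unfolding bessel_shift_def[abs_def] by measurable

context radial_weights
begin

definition S :: "nat \<Rightarrow> real \<Rightarrow> (real \<Rightarrow> real) \<Rightarrow> real \<Rightarrow> real" where
  "S k s h x = (\<integral>p. h (bessel_shift s x p) \<partial>mu k)"

context
  fixes k L :: nat and s H :: real and h :: "real \<Rightarrow> real"
  assumes k: "k \<le> m" and s: "0 \<le> s"
    and h_cont: "continuous_on UNIV h"
    and h_growth: "\<And>w. 0 \<le> w \<Longrightarrow> \<bar>h w\<bar> \<le> H * (1 + w ^ L)"
begin

lemma h_measurable: "h \<in> borel_measurable borel"
  using h_cont by (rule borel_measurable_continuous_onI)

lemma AE_h_shift_le: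
  "AE p in mu k. \<forall>x\<in>{0..c}. \<bar>h (bessel_shift s x p)\<bar> \<le>
    H * (1 + (sqrt c + s) ^ (2 * L)) * (1 + fst p) ^ (2 * L)"
  using AE_mu[OF k] by eventually_elim (auto intro!: abs_shift_le h_growth s)

lemma S_integrable:
  assumes "0 \<le> x"
  shows "integrable (mu k) (\<lambda>p. h (bessel_shift s x p))"
proof (rule Bochner_Integration.integrable_bound)
  show "integrable (mu k) (\<lambda>p. H * (1 + (sqrt x + s) ^ (2 * L)) * (1 + fst p) ^ (2 * L))"
    using mu_moments[OF k] by simp
  show "AE p in mu k. norm (h (bessel_shift s x p)) \<le>
      norm (H * (1 + (sqrt x + s) ^ (2 * L)) * (1 + fst p) ^ (2 * L))"
    using AE_h_shift_le[of x] by eventually_elim (use assms in \<open>force dest!: bspec[of _ _ x]\<close>)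
qed (use h_measurable in measurable)

lemma S_continuous: "continuous_on {0..} (S k s h)"
proof (rule continuous_on_atLeastI)
  note [measurable] = h_measurable
  fix c :: real
  show "continuous_on {0..c} (S k s h)"
    unfolding S_def[abs_def]
  proof (rule continuous_on_integral_dominated)
    show "integrable (mu k) (\<lambda>p. H * (1 + (sqrt c + s) ^ (2 * L)) * (1 + fst p) ^ (2 * L))"
      using mu_moments[OF k] by simp
    show "AE p in mu k. continuous_on {0..c} (\<lambda>x. h (bessel_shift s x p)) \<and>
        (\<forall>x\<in>{0..c}. \<bar>h (bessel_shift s x p)\<bar> \<le> H * (1 + (sqrt c + s) ^ (2 * L)) * (1 + fst p) ^ (2 * L))"
      using AE_h_shift_le[of c]
    proof eventually_elim
      case (elim p)
      have "continuous_on {0..c} (\<lambda>x. bessel_shift s x (fst p, snd p))"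
        by (intro continuous_intros)
      then show ?case
        using elim by (auto intro!: continuous_on_compose2[OF h_cont])
    qed
  qed measurable
qed

lemma nu_section_continuous:
  assumes x: "0 \<le> x" and g: "continuous_on UNIV g"
  shows "continuous_on {0..} (\<lambda>R. \<integral>y. h (bessel_shift s x (R, y)) * g y \<partial>nu k)"
    and "continuous_on {0..} (\<lambda>R. \<integral>y. h (bessel_shift s x (R, y)) * (R * g y) \<partial>nu k)"
proof -
  note [measurable] = h_measurable
  interpret finite_measure "nu k" by (rule finite_measure_nu)
  have [measurable]: "g \<in> borel_measurable borel"
    using g by (rule borel_measurable_continuous_onI)
  have *: "continuous_on {0..N} (\<lambda>R. \<integral>y. h (bessel_shift s x (R, y)) * g y \<partial>nu k)" for N
  proof (rule continuous_on_integral_dominated)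
    let ?g = "\<lambda>y. H * (1 + (sqrt x + s) ^ (2 * L)) * (1 + N) ^ (2 * L) * \<bar>g y\<bar>"
    show "integrable (nu k) ?g"
      using g by (intro nu_integrable continuous_intros)
    show "AE y in nu k. continuous_on {0..N} (\<lambda>R. h (bessel_shift s x (R, y)) * g y) \<and>
        (\<forall>R\<in>{0..N}. \<bar>h (bessel_shift s x (R, y)) * g y\<bar> \<le> ?g y)"
      using AE_nu
    proof eventually_elim
      case (elim y)
      have "continuous_on {0..N} (\<lambda>R. h (bessel_shift s x (R, y)) * g y)"
        by (intro continuous_intros continuous_on_compose2[OF h_cont]) auto
      moreover have "\<bar>h (bessel_shift s x (R, y)) * g y\<bar> \<le> ?g y" if R: "R \<in> {0..N}" for R
      proof -
        have H: "0 \<le> H" using h_growth by (rule growth_const_nonneg)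
        have "\<bar>h (bessel_shift s x (R, y))\<bar> \<le> H * (1 + (sqrt x + s) ^ (2 * L)) * (1 + R) ^ (2 * L)"
          using abs_shift_le[of h H L s x x "(R, y)"] h_growth s x R elim by simp
        also have "\<dots> \<le> H * (1 + (sqrt x + s) ^ (2 * L)) * (1 + N) ^ (2 * L)"
          using R H s x by (intro mult_left_mono power_mono) auto
        finally show ?thesis by (simp add: abs_mult mult_right_mono)
      qed
      ultimately show ?case by blast
    qed
  qed measurable
  then show 1: "continuous_on {0..} (\<lambda>R. \<integral>y. h (bessel_shift s x (R, y)) * g y \<partial>nu k)"
    by (rule continuous_on_atLeastI)
  have "(\<integral>y. h (bessel_shift s x (R, y)) * (R * g y) \<partial>nu k) = R * (\<integral>y. h (bessel_shift s x (R, y)) * g y \<partial>nu k)" for R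
    by (simp add: mult.left_commute)
  then show "continuous_on {0..} (\<lambda>R. \<integral>y. h (bessel_shift s x (R, y)) * (R * g y) \<partial>nu k)"
    using 1 by (auto intro!: continuous_intros)
qed

end

end

section \<open>Differentiation of the averages in the starting point\<close>

context radial_weights
begin

lemma mu_section_integrable:
  fixes f :: "real \<times> real \<Rightarrow> real"
  assumes k: "k \<le> m" and f: "integrable (mu k) f"
  shows "integrable lborel (\<lambda>R. indicator {0..} R * (W k R * (\<integral>y. f (R, y) \<partial>nu k)))"
    and "(\<integral>R. indicator {0..} R * (W k R * (\<integral>y. f (R, y) \<partial>nu k)) \<partial>lborel) = (\<integral>p. f p \<partial>mu k)"
proof -
  interpret pair_sigma_finite "rad k" "nu k" by (rule pair_rad_nu[OF k])
  have int: "integrable (rad k) (\<lambda>R. \<integral>y. f (R, y) \<partial>nu k)"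
    using integrable_fst'[of f] f by (simp add: mu_def)
  then have meas: "(\<lambda>R. \<integral>y. f (R, y) \<partial>nu k) \<in> borel_measurable borel"
    using borel_measurable_integrable[OF int] by simp
  show "integrable lborel (\<lambda>R. indicator {0..} R * (W k R * (\<integral>y. f (R, y) \<partial>nu k)))"
    using int rad_integrable[OF k meas] by simp
  show "(\<integral>R. indicator {0..} R * (W k R * (\<integral>y. f (R, y) \<partial>nu k)) \<partial>lborel) = (\<integral>p. f p \<partial>mu k)"
    using mu_integral[OF k f] rad_integral[OF k meas] by simp
qed

text \<open>Removes the boundary term of \<open>W_by_parts\<close> as N grows.
  \<open>W_decay\<close> is used with one power more than the growth of \<open>n * B n\<close>
  demands, which leaves a factor 1 / n.\<close>

lemma W_boundary_tendsto_0:
  assumes k: "k < m" and B: "\<And>R. 0 \<le> R \<Longrightarrow> \<bar>B R\<bar> \<le> c * (1 + R) ^ j"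
  shows "(\<lambda>n. W k (real n) * (real n * B (real n))) \<longlonglongrightarrow> 0"
proof (rule tendsto_0_le[where K = 1])
  define C where "C = real (Suc (2 * k + Suc j)) * (\<integral>R. indicator {0..} R * (W k R * R ^ Suc j) \<partial>lborel)"
  have c: "0 \<le> c" using order_trans[OF abs_ge_zero B[of 0]] by simp
  show "(\<lambda>n. c * 2 ^ j * C * inverse (real n)) \<longlonglongrightarrow> 0"
    using tendsto_mult_right_zero[OF lim_inverse_n] .
  have "norm (W k n * (n * B n)) \<le> norm (c * 2 ^ j * C * inverse (real n)) * 1" if n: "n \<ge> 1" for n :: nat
  proof -
    have W: "0 \<le> W k n" using W_nonneg k by simp
    have "\<bar>B n\<bar> \<le> c * (2 * n) ^ j"
    proof -
      have "(1 + real n) ^ j \<le> (2 * real n) ^ j" using n by (intro power_mono) auto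
      then show ?thesis using B[of n] c by (auto elim!: order_trans intro!: mult_left_mono)
    qed
    then have "norm (W k n * (n * B n)) \<le> W k n * (n * (c * (2 * n) ^ j))"
      using W by (simp add: abs_mult mult_left_mono)
    also have "\<dots> = c * 2 ^ j * (W k n * real n ^ Suc (Suc j)) * inverse n"
      using n by (simp add: power_mult_distrib field_simps)
    also have "\<dots> \<le> c * 2 ^ j * C * inverse n"
      unfolding C_def using c n by (intro mult_right_mono mult_left_mono W_decay k) auto
    finally show ?thesis by simp
  qed
  then show "\<forall>\<^sub>F n in sequentially. norm (W k (real n) * (real n * B (real n)))
      \<le> norm (c * 2 ^ j * C * inverse (real n)) * 1"
    by (rule eventually_sequentiallyI)
qed

lemma bessel_shift_deriv:
  "0 < x \<Longrightarrow> ((\<lambda>x. bessel_shift s x p) has_real_derivative 1 + s * fst p * snd p / sqrt x) (at x within A)"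
  "((\<lambda>R. bessel_shift s x (R, y)) has_real_derivative 2 * s\<^sup>2 * R + 2 * s * sqrt x * y) (at R within A)"
  "((\<lambda>y. bessel_shift s x (R, y)) has_real_derivative 2 * s * R * sqrt x) (at y within A)"
  unfolding bessel_shift_def
  by (auto intro!: derivative_eq_intros simp: field_simps power2_eq_square)

context
  fixes k L :: nat and s H x :: real and h h' :: "real \<Rightarrow> real"
  assumes k: "k < m" and s: "0 < s" and x: "0 < x"
    and h_cont: "continuous_on UNIV h" and h'_cont: "continuous_on UNIV h'"
    and h_growth: "\<And>w. 0 \<le> w \<Longrightarrow> \<bar>h w\<bar> \<le> H * (1 + w ^ L)"
    and h'_growth: "\<And>w. 0 \<le> w \<Longrightarrow> \<bar>h' w\<bar> \<le> H * (1 + w ^ L)"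
    and deriv: "\<And>w. 0 \<le> w \<Longrightarrow> (h has_real_derivative h' w) (at w within {0..})"
begin

lemma measurable_jet: "h \<in> borel_measurable borel" "h' \<in> borel_measurable borel"
  using h_cont h'_cont by (auto intro: borel_measurable_continuous_onI)

lemma continuous_on_shifted:
  "continuous_on A (\<lambda>y. h (bessel_shift s x (R, y)))"
  "continuous_on A (\<lambda>y. h' (bessel_shift s x (R, y)))"
  by (intro continuous_intros continuous_on_compose2[OF h_cont] continuous_on_compose2[OF h'_cont]; simp)+

text \<open>The derivative still contains \<open>1 / sqrt x\<close>. Dominating it requires an
  interval around \<open>x\<close> that stays away from 0.\<close>

lemma S_deriv_under_integral:
  shows "(S k s h has_real_derivative
      (\<integral>p. h' (bessel_shift s x p) * (1 + s * fst p * snd p / sqrt x) \<partial>mu k)) (at x)"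
    and "integrable (mu k) (\<lambda>p. h' (bessel_shift s x p) * (1 + s * fst p * snd p / sqrt x))"
proof -
  note [measurable] = measurable_jet
  let ?I = "{x / 2<..<2 * x}"
  let ?f' = "\<lambda>x p. h' (bessel_shift s x p) * (1 + s * fst p * snd p / sqrt x)"
  define C where "C = H * (1 + (sqrt (2 * x) + s) ^ (2 * L)) * (1 + s / sqrt (x / 2))"
  have H: "0 \<le> H" using h_growth by (rule growth_const_nonneg)
  have xI: "x \<in> ?I" using x by simp
  have g: "integrable (mu k) (\<lambda>p. C * (1 + fst p) ^ Suc (2 * L))"
    using mu_moments[of k "Suc (2 * L)"] k by (intro integrable_mult_right) simp_all
  have AE: "AE p in mu k. \<forall>x'\<in>?I. ((\<lambda>x. h (bessel_shift s x p)) has_real_derivative ?f' x' p) (at x')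
      \<and> \<bar>?f' x' p\<bar> \<le> C * (1 + fst p) ^ Suc (2 * L)"
    using AE_mu[OF less_imp_le[OF k]]
  proof (eventually_elim, intro ballI conjI)
    fix p :: "real \<times> real" and x' :: real
    assume p: "0 \<le> fst p \<and> \<bar>snd p\<bar> \<le> 1" and x': "x' \<in> ?I"
    have x'0: "0 < x'" using x x' by simp
    have "((\<lambda>x. h (bessel_shift s x p)) has_real_derivative ?f' x' p) (at x' within ?I)"
      by (rule has_real_derivative_compose_within[where T = "{0..}"])
        (use p x' x x'0 in \<open>auto intro!: deriv bessel_shift_deriv bessel_shift_nonneg\<close>)
    then show "((\<lambda>x. h (bessel_shift s x p)) has_real_derivative ?f' x' p) (at x')"
      using x' by (subst (asm) at_within_open) auto
    have "\<bar>h' (bessel_shift s x' p)\<bar> \<le> H * (1 + (sqrt (2 * x) + s) ^ (2 * L)) * (1 + fst p) ^ (2 * L)"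
      using h'_growth s p x' x'0 by (intro abs_shift_le) auto
    moreover have "\<bar>1 + s * fst p * snd p / sqrt x'\<bar> \<le> (1 + s / sqrt (x / 2)) * (1 + fst p)"
    proof -
      have "\<bar>s * fst p * snd p / sqrt x'\<bar> = s * fst p * \<bar>snd p\<bar> / sqrt x'"
        using s p x'0 by (simp add: abs_mult)
      also have "\<dots> \<le> s * fst p * 1 / sqrt (x / 2)"
        using s p x'0 x' x by (intro frac_le mult_left_mono) auto
      also have "\<dots> = s / sqrt (x / 2) * fst p" by simp
      finally have "\<bar>1 + s * fst p * snd p / sqrt x'\<bar> \<le> 1 + s / sqrt (x / 2) * fst p"
        by linarith
      also have "\<dots> \<le> (1 + s / sqrt (x / 2)) * (1 + fst p)"
        using p mult_nonneg_nonneg[of "s / sqrt (x / 2)" "fst p"] s x by (simp add: distrib_left distrib_right)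
      finally show ?thesis .
    qed
    ultimately have "\<bar>?f' x' p\<bar> \<le> (H * (1 + (sqrt (2 * x) + s) ^ (2 * L)) * (1 + fst p) ^ (2 * L)) *
        ((1 + s / sqrt (x / 2)) * (1 + fst p))"
      unfolding abs_mult by (rule mult_mono) (use H p s x in auto)
    also have "\<dots> = C * (1 + fst p) ^ Suc (2 * L)"
      by (simp add: C_def mult_ac)
    finally show "\<bar>?f' x' p\<bar> \<le> C * (1 + fst p) ^ Suc (2 * L)" .
  qed
  show "(S k s h has_real_derivative (\<integral>p. ?f' x p \<partial>mu k)) (at x)"
    unfolding S_def[abs_def]
  proof (rule has_real_derivative_integral_dominated[OF xI _ _ g AE])
    show "integrable (mu k) (\<lambda>p. h (bessel_shift s x' p))" if "x' \<in> ?I" for x'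
      using k s x that by (intro S_integrable[OF _ _ h_cont h_growth]) auto
  qed measurable
  show "integrable (mu k) (\<lambda>p. ?f' x p)"
  proof (rule Bochner_Integration.integrable_bound[OF g])
    show "AE p in mu k. norm (?f' x p) \<le> norm (C * (1 + fst p) ^ Suc (2 * L))"
      using AE
    proof eventually_elim
      case (elim p)
      then have "\<bar>?f' x p\<bar> \<le> C * (1 + fst p) ^ Suc (2 * L)" using xI by blast
      then show ?case unfolding real_norm_def by linarith
    qed
  qed measurable
qed

text \<open>The average over the coordinate with the index \<open>Suc k\<close> of the desired
  derivative. Despite its name, \<open>inner_mean_deriv\<close> is the derivative of
  \<open>R * inner_mean R\<close>.\<close>

definition "inner_mean R = (\<integral>y. h' (bessel_shift s x (R, y)) \<partial>nu (Suc k))"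
definition "inner_mean_deriv R = (\<integral>y. h' (bessel_shift s x (R, y)) * (s * R * y / sqrt x + y\<^sup>2) \<partial>nu k)"

lemma inner_mean_deriv_eq: "inner_mean_deriv R = (\<integral>y. h' (bessel_shift s x (R, y)) * (R * (s * y / sqrt x)) \<partial>nu k) +
    (\<integral>y. h' (bessel_shift s x (R, y)) * y\<^sup>2 \<partial>nu k)"
  unfolding inner_mean_deriv_def
  by (subst Bochner_Integration.integral_add[symmetric])
    (use x in \<open>auto intro!: nu_integrable continuous_intros continuous_on_shifted simp: algebra_simps\<close>)

lemma inner_mean_continuous: "continuous_on {0..} inner_mean_deriv" "continuous_on {0..} inner_mean"
proof -
  show "continuous_on {0..} inner_mean_deriv"
    unfolding inner_mean_deriv_eq[abs_def] using k s x
    by (intro continuous_intros nu_section_continuous[OF _ _ h'_cont h'_growth]) auto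
  show "continuous_on {0..} inner_mean"
    using nu_section_continuous(1)[OF _ _ h'_cont h'_growth, of "Suc k" s x "\<lambda>_. 1"] k s x
    by (simp add: inner_mean_def[abs_def])
qed

text \<open>Integration by parts in \<open>y\<close> replaces \<open>h'\<close> by \<open>h\<close>.
  The right-hand side can thus be differentiated in \<open>R\<close>, although \<open>h'\<close> is
  only continuous.\<close>

lemma inner_mean_by_parts: "R * inner_mean R = (\<integral>y. h (bessel_shift s x (R, y)) * y \<partial>nu k) / (2 * s * sqrt x)"
  if "0 \<le> R"
proof -
  have "(\<integral>y. h' (bessel_shift s x (R, y)) * (2 * s * R * sqrt x) \<partial>nu (Suc k)) =
      (\<integral>y. h (bessel_shift s x (R, y)) * y \<partial>nu k)"
  proof (rule nu_by_parts)
    fix y :: real assume "y \<in> {- 1..1}"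
    then show "((\<lambda>y. h (bessel_shift s x (R, y))) has_real_derivative
        h' (bessel_shift s x (R, y)) * (2 * s * R * sqrt x)) (at y within {- 1..1})"
      by - (rule has_real_derivative_compose_within[where T = "{0..}"],
        use x in \<open>auto intro!: deriv bessel_shift_deriv bessel_shift_nonneg\<close>)
  qed (auto intro!: continuous_intros continuous_on_shifted)
  then show ?thesis
    using s x by (simp add: inner_mean_def field_simps)
qed

text \<open>For \<open>R > 0\<close>, differentiate the right-hand side of
  \<open>inner_mean_by_parts\<close> under the integral; the factor is (2 s^2 R + 2 s sqrt x y) y /
  (2 s sqrt x) = s R y / sqrt x + y^2. Continuity of both sides settles
  \<open>R = 0\<close>.\<close>

lemma inner_mean_has_deriv:
  assumes "0 \<le> R"
  shows "((\<lambda>R. R * inner_mean R) has_real_derivative inner_mean_deriv R) (at R within {0..})"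
proof (rule has_real_derivative_within_atLeast[OF _ inner_mean_continuous(1) _ assms])
  show "continuous_on {0..} (\<lambda>R. R * inner_mean R)"
    by (intro continuous_intros inner_mean_continuous)
next
  fix R :: real assume R: "0 < R"
  let ?J = "\<lambda>R. \<integral>y. h (bessel_shift s x (R, y)) * y \<partial>nu k"
  let ?f' = "\<lambda>R y. h' (bessel_shift s x (R, y)) * (2 * s\<^sup>2 * R + 2 * s * sqrt x * y) * y"
  let ?I = "{0<..<R + 1}"
  define C where "C = H * (1 + (sqrt x + s) ^ (2 * L)) * (1 + (R + 1)) ^ (2 * L) * (2 * s\<^sup>2 * (R + 1) + 2 * s * sqrt x)"
  have H: "0 \<le> H" using h_growth by (rule growth_const_nonneg)
  interpret finite_measure "nu k" by (rule finite_measure_nu)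
  have "(?J has_real_derivative (\<integral>y. ?f' R y \<partial>nu k)) (at R)"
  proof (rule has_real_derivative_integral_dominated[where g = "\<lambda>_. C"])
    show "R \<in> ?I" using R by simp
    show "integrable (nu k) (\<lambda>y. h (bessel_shift s x (R', y)) * y)" for R'
      by (intro nu_integrable continuous_intros continuous_on_shifted)
    show "AE y in nu k. \<forall>R'\<in>?I. ((\<lambda>R. h (bessel_shift s x (R, y)) * y) has_real_derivative ?f' R' y) (at R')
        \<and> \<bar>?f' R' y\<bar> \<le> C"
      using AE_nu
    proof (eventually_elim, intro ballI conjI)
      fix y R' :: real assume y: "\<bar>y\<bar> \<le> 1" and R': "R' \<in> ?I"
      have "((\<lambda>R. h (bessel_shift s x (R, y))) has_real_derivative
          h' (bessel_shift s x (R', y)) * (2 * s\<^sup>2 * R' + 2 * s * sqrt x * y)) (at R' within ?I)"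
        by (rule has_real_derivative_compose_within[where T = "{0..}"])
          (use x y in \<open>auto intro!: deriv bessel_shift_deriv bessel_shift_nonneg\<close>)
      then show "((\<lambda>R. h (bessel_shift s x (R, y)) * y) has_real_derivative ?f' R' y) (at R')"
        using R' by (subst (asm) at_within_open) (auto intro!: DERIV_cmult_right)
      have "\<bar>h' (bessel_shift s x (R', y))\<bar> \<le> H * (1 + (sqrt x + s) ^ (2 * L)) * (1 + R') ^ (2 * L)"
        using abs_shift_le[of h' H L s x x "(R', y)"] h'_growth s x R' y by simp
      also have "\<dots> \<le> H * (1 + (sqrt x + s) ^ (2 * L)) * (1 + (R + 1)) ^ (2 * L)"
        using R' H s x by (intro mult_left_mono power_mono) auto
      finally have 1: "\<bar>h' (bessel_shift s x (R', y))\<bar> \<le> H * (1 + (sqrt x + s) ^ (2 * L)) * (1 + (R + 1)) ^ (2 * L)" .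
      have "\<bar>2 * s\<^sup>2 * R' + 2 * s * sqrt x * y\<bar> \<le> \<bar>2 * s\<^sup>2 * R'\<bar> + \<bar>2 * s * sqrt x * y\<bar>"
        by (rule abs_triangle_ineq)
      also have "\<dots> \<le> 2 * s\<^sup>2 * (R + 1) + 2 * s * sqrt x * 1"
        using s x R' y by (simp add: abs_mult add_mono mult_left_mono)
      finally have 2: "\<bar>2 * s\<^sup>2 * R' + 2 * s * sqrt x * y\<bar> \<le> 2 * s\<^sup>2 * (R + 1) + 2 * s * sqrt x"
        by simp
      have "\<bar>?f' R' y\<bar> \<le> C * 1"
        unfolding abs_mult C_def by (intro mult_mono 1 2 y) (use H s x R in auto)
      then show "\<bar>?f' R' y\<bar> \<le> C" by simp
    qed
    show "(\<lambda>y. ?f' R y) \<in> borel_measurable (nu k)"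
      by (intro borel_measurable_integrable nu_integrable continuous_intros continuous_on_shifted)
  qed auto
  moreover have "(\<integral>y. ?f' R y \<partial>nu k) = inner_mean_deriv R * (2 * s * sqrt x)"
  proof -
    have "inner_mean_deriv R * (2 * s * sqrt x) = (\<integral>y. h' (bessel_shift s x (R, y)) * (s * R * y / sqrt x + y\<^sup>2) * (2 * s * sqrt x) \<partial>nu k)"
      by (simp add: inner_mean_deriv_def)
    also have "\<dots> = (\<integral>y. ?f' R y \<partial>nu k)"
      using x s by (intro Bochner_Integration.integral_cong) (auto simp: field_simps power2_eq_square)
    finally show ?thesis ..
  qed
  ultimately have "((\<lambda>R. ?J R / (2 * s * sqrt x)) has_real_derivative inner_mean_deriv R) (at R)"
    using s x by (auto dest: DERIV_cdivide[where c = "2 * s * sqrt x"])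
  then show "((\<lambda>R. R * inner_mean R) has_real_derivative inner_mean_deriv R) (at R)"
    by (rule has_field_derivative_transform_within_open[where S = "{0<..}"])
      (use R inner_mean_by_parts in auto)
qed

text \<open>By \<open>nu_weight\<close>, \<open>2 * real k * inner_mean R\<close> is the average of
  (1 - y^2) h' under \<open>nu k\<close>. Adding \<open>inner_mean_deriv R\<close> cancels y^2 and
  leaves exactly the factor 1 + s R y / sqrt x of \<open>S_deriv_under_integral\<close>.
  \<open>W_by_parts\<close> with \<open>inner_mean\<close> as \<open>B\<close> moves the result to
  \<open>W (Suc k)\<close>, on intervals from 0 to n with n tending to infinity.\<close>

lemma S_deriv: "(S k s h has_real_derivative S (Suc k) s h' x) (at x)"
proof -
  note [measurable] = measurable_jet
  have Sk: "Suc k \<le> m" using k by simp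
  let ?f = "\<lambda>p. h' (bessel_shift s x p) * (1 + s * fst p * snd p / sqrt x)"
  have int: "integrable (mu (Suc k)) (\<lambda>p. h' (bessel_shift s x p))"
    using s x by (intro S_integrable[OF Sk _ h'_cont h'_growth]) auto
  have eq: "2 * real k * inner_mean R + inner_mean_deriv R = (\<integral>y. ?f (R, y) \<partial>nu k)" for R
  proof -
    have "2 * real k * inner_mean R = (\<integral>y. (1 - y\<^sup>2) * h' (bessel_shift s x (R, y)) \<partial>nu k)"
      unfolding inner_mean_def by (rule nu_weight) measurable
    then have "2 * real k * inner_mean R + inner_mean_deriv R = (\<integral>y. (1 - y\<^sup>2) * h' (bessel_shift s x (R, y)) +
        h' (bessel_shift s x (R, y)) * (s * R * y / sqrt x + y\<^sup>2) \<partial>nu k)"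
      unfolding inner_mean_deriv_def using x
      by (subst Bochner_Integration.integral_add) (auto intro!: nu_integrable continuous_intros continuous_on_shifted)
    then show ?thesis by (simp add: algebra_simps)
  qed
  have "(\<lambda>n. \<integral>R. indicator {0..real n} R * (W (Suc k) R * inner_mean R) \<partial>lborel) \<longlonglongrightarrow> S (Suc k) s h' x"
    using tendsto_integral_indicator_Icc[OF mu_section_integrable(1)[OF Sk int]]
    by (simp add: mu_section_integrable(2)[OF Sk int] inner_mean_def S_def)
  moreover have "(\<lambda>n. (\<integral>R. indicator {0..real n} R * (W k R * (2 * real k * inner_mean R + inner_mean_deriv R)) \<partial>lborel)
      - W k (real n) * (real n * inner_mean (real n))) \<longlonglongrightarrow> (\<integral>p. ?f p \<partial>mu k) - 0"
  proof (rule tendsto_diff)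
    have k': "k \<le> m" using k by simp
    show "(\<lambda>n. \<integral>R. indicator {0..real n} R * (W k R * (2 * real k * inner_mean R + inner_mean_deriv R)) \<partial>lborel)
        \<longlonglongrightarrow> (\<integral>p. ?f p \<partial>mu k)"
      using tendsto_integral_indicator_Icc[OF mu_section_integrable(1)[OF k' S_deriv_under_integral(2)]]
      unfolding mu_section_integrable(2)[OF k' S_deriv_under_integral(2)] eq .
    interpret finite_measure "nu (Suc k)" by (rule finite_measure_nu)
    show "(\<lambda>n. W k (real n) * (real n * inner_mean (real n))) \<longlonglongrightarrow> 0"
    proof (rule W_boundary_tendsto_0[OF k])
      fix R :: real assume R: "0 \<le> R"
      let ?c = "H * (1 + (sqrt x + s) ^ (2 * L)) * (1 + R) ^ (2 * L)"
      have "\<bar>inner_mean R\<bar> \<le> (\<integral>y. \<bar>h' (bessel_shift s x (R, y))\<bar> \<partial>nu (Suc k))"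
        unfolding inner_mean_def by (rule integral_abs_bound)
      also have "\<dots> \<le> (\<integral>y. ?c \<partial>nu (Suc k))"
      proof (rule integral_mono_AE)
        show "AE y in nu (Suc k). \<bar>h' (bessel_shift s x (R, y))\<bar> \<le> ?c"
          using AE_nu
        proof eventually_elim
          case (elim y)
          then show ?case
            using abs_shift_le[of h' H L s x x "(R, y)"] h'_growth s x R by simp
        qed
      qed (auto intro!: nu_integrable continuous_intros continuous_on_shifted)
      finally show "\<bar>inner_mean R\<bar> \<le> (measure (nu (Suc k)) UNIV * (H * (1 + (sqrt x + s) ^ (2 * L)))) * (1 + R) ^ (2 * L)"
        by (simp add: mult_ac)
    qed
  qed
  ultimately have "S (Suc k) s h' x = (\<integral>p. ?f p \<partial>mu k)"
    using W_by_parts[OF k _ inner_mean_continuous(2,1) inner_mean_has_deriv] by (auto intro: LIMSEQ_unique)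
  then show ?thesis using S_deriv_under_integral(1) by simp
qed

end

end

subsection \<open>Moment bounds\<close>

text \<open>Because q^2 is of order 1 + x and not (1 + x)^2, the Taylor remainder has degree L - 1
  in x; the factor \<open>1 + x\<close> on the left expresses this without subtracting in the
  exponent. In the induction, the remainder for \<open>Suc L\<close> is \<open>x + q\<close> times
  that for \<open>L\<close>, plus \<open>L * x ^ (L - 1) * q\<^sup>2\<close>.\<close>

lemma power_add_remainder:
  fixes x q d e :: real
  assumes "0 \<le> x" "0 \<le> d" "0 \<le> e" and q: "\<bar>q\<bar> \<le> x + d" and qq: "q\<^sup>2 \<le> e * (1 + x)"
  shows "(1 + x) * \<bar>(x + q) ^ L - x ^ L - L * x ^ (L - 1) * q\<bar> \<le> e * L * (2 + d) ^ L * (1 + x) ^ L"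
proof (induction L)
  case (Suc L)
  define D where "D = (x + q) ^ L - x ^ L - L * x ^ (L - 1) * q"
  have eq: "(x + q) ^ Suc L - x ^ Suc L - Suc L * x ^ (Suc L - 1) * q = (x + q) * D + L * x ^ (L - 1) * q\<^sup>2"
    by (cases L) (simp_all add: D_def algebra_simps power2_eq_square)
  have xq: "\<bar>x + q\<bar> \<le> (2 + d) * (1 + x)"
  proof -
    have "\<bar>x + q\<bar> \<le> 2 * x + d" using q assms by linarith
    also have "\<dots> \<le> 2 * x + d + (2 + d * x)" using assms by simp
    finally show ?thesis by (simp add: algebra_simps)
  qed
  have 1: "(1 + x) * \<bar>(x + q) * D\<bar> \<le> ((2 + d) * (1 + x)) * (e * L * (2 + d) ^ L * (1 + x) ^ L)"
    using mult_mono[OF xq Suc.IH[folded D_def]] assms by (simp add: abs_mult mult.left_commute)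
  have 2: "(1 + x) * (L * x ^ (L - 1) * q\<^sup>2) \<le> e * L * (1 + x) ^ Suc L"
  proof (cases L)
    case (Suc l)
    have "(1 + x) * (L * x ^ l * q\<^sup>2) \<le> (1 + x) * (L * (1 + x) ^ l * (e * (1 + x)))"
      using assms by (intro mult_left_mono mult_mono power_mono) auto
    then show ?thesis by (simp add: Suc mult_ac)
  qed simp
  have 3: "real L \<le> (2 + d) ^ Suc L"
  proof -
    have "real L \<le> 2 ^ Suc L"
      using of_nat_less_two_power[of L, where 'a = real] unfolding power_Suc by linarith
    also have "\<dots> \<le> (2 + d) ^ Suc L" using assms by (intro power_mono) auto
    finally show ?thesis .
  qed
  have "(1 + x) * \<bar>(x + q) * D + L * x ^ (L - 1) * q\<^sup>2\<bar>
      \<le> (1 + x) * \<bar>(x + q) * D\<bar> + (1 + x) * (L * x ^ (L - 1) * q\<^sup>2)"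
    using assms abs_triangle_ineq[of "(x + q) * D" "L * x ^ (L - 1) * q\<^sup>2"]
    by (simp add: distrib_left[symmetric] mult_left_mono)
  also have "\<dots> \<le> e * (1 + x) ^ Suc L * (L * (2 + d) ^ Suc L + L)"
    using 1 2 by (simp add: algebra_simps)
  also have "\<dots> \<le> e * (1 + x) ^ Suc L * (L * (2 + d) ^ Suc L + (2 + d) ^ Suc L)"
    using 3 assms by (intro mult_left_mono add_left_mono) auto
  finally show ?case unfolding eq by (simp add: algebra_simps)
qed simp

context radial_weights
begin

lemma mu_integrable_bound:
  fixes f :: "real \<times> real \<Rightarrow> real"
  assumes "k \<le> m" "f \<in> borel_measurable (borel \<Otimes>\<^sub>M borel)"
    and f: "\<And>p. 0 \<le> fst p \<Longrightarrow> \<bar>snd p\<bar> \<le> 1 \<Longrightarrow> \<bar>f p\<bar> \<le> c * (1 + fst p) ^ j"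
  shows "integrable (mu k) f"
proof (rule Bochner_Integration.integrable_bound)
  show "integrable (mu k) (\<lambda>p. c * (1 + fst p) ^ j)"
    using mu_moments[OF assms(1)] by simp
  show "AE p in mu k. norm (f p) \<le> norm (c * (1 + fst p) ^ j)"
    using AE_mu[OF assms(1)]
  proof eventually_elim
    case (elim p)
    then show ?case using f[of p] by simp
  qed
qed (use assms in measurable)

text \<open>The term of order s is odd in the coordinate, which has mean zero, so the mean
  displacement is of order s^2, hence of order t.\<close>

lemma bessel_shift_mean:
  assumes k: "k \<le> m" and x: "0 \<le> x"
  shows "integrable (mu k) (\<lambda>p. bessel_shift s x p - x)"
    and "(\<integral>p. bessel_shift s x p - x \<partial>mu k) = s\<^sup>2 * (\<integral>p. (fst p)\<^sup>2 \<partial>mu k)"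
proof -
  have 1: "integrable (mu k) (\<lambda>p. (fst p)\<^sup>2)"
    by (rule mu_integrable_bound[OF k, where c = 1 and j = 2]) (auto intro!: power_mono)
  have 2: "integrable (mu k) (\<lambda>p. fst p * snd p)"
  proof (rule mu_integrable_bound[OF k, where c = 1 and j = 1])
    show "\<bar>fst p * snd p\<bar> \<le> 1 * (1 + fst p) ^ 1" if "0 \<le> fst p" "\<bar>snd p\<bar> \<le> 1" for p :: "real \<times> real"
      using mult_mono[of "fst p" "1 + fst p" "\<bar>snd p\<bar>" 1] that by (simp add: abs_mult)
  qed measurable
  have 3: "(\<integral>p. fst p * snd p \<partial>mu k) = 0"
    using mu_integral[OF k 2] nu_mean_zero by simp
  have eq: "bessel_shift s x p - x = s\<^sup>2 * (fst p)\<^sup>2 + 2 * s * sqrt x * (fst p * snd p)" for p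
    by (simp add: bessel_shift_def power_mult_distrib)
  show "integrable (mu k) (\<lambda>p. bessel_shift s x p - x)"
    unfolding eq using 1 2 by (intro Bochner_Integration.integrable_add integrable_mult_right)
  show "(\<integral>p. bessel_shift s x p - x \<partial>mu k) = s\<^sup>2 * (\<integral>p. (fst p)\<^sup>2 \<partial>mu k)"
    unfolding eq using 1 2 3 by (subst Bochner_Integration.integral_add) auto
qed

text \<open>The linear term is kept exact: pointwise it is only O(s), and it becomes O(s^2) after
  integration. Everything else already carries s^2.\<close>

lemma bessel_shift_power_le:
  assumes s: "0 \<le> s" "s \<le> s0" and x: "0 \<le> x" and p: "0 \<le> fst p" "\<bar>snd p\<bar> \<le> 1"
  shows "bessel_shift s x p ^ L \<le> x ^ L + L * x ^ (L - 1) * (bessel_shift s x p - x) +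
    s\<^sup>2 * ((2 * s0\<^sup>2 + 8) * L * (2 + 2 * s0\<^sup>2) ^ L) * (1 + fst p) ^ (4 + 2 * L) * (1 + x) ^ L"
proof -
  define R q where "R = fst p" and "q = bessel_shift s x p - x"
  \<comment> \<open>\<open>?d\<close> comes from 2 s R sqrt x <= s^2 R^2 + x, so |q| <= x + 2 s^2
    R^2. \<open>?e\<close> comes from q^2 <= 2 (s^2 R^2)^2 + 2 (2 s R sqrt x)^2, where one factor
    s^2 is kept and any other is bounded by s0^2.\<close>
  let ?d = "2 * s0\<^sup>2 * R\<^sup>2" and ?e = "s\<^sup>2 * (2 * s0\<^sup>2 * R ^ 4 + 8 * R\<^sup>2)"
  have R: "0 \<le> R" using p by (simp add: R_def)
  have ss: "s\<^sup>2 \<le> s0\<^sup>2" using s by (intro power_mono) auto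
  have abs_q: "\<bar>q\<bar> \<le> s\<^sup>2 * R\<^sup>2 + 2 * s * R * sqrt x"
  proof -
    have "\<bar>2 * s * R * sqrt x * snd p\<bar> \<le> 2 * s * R * sqrt x * 1"
      unfolding abs_mult using s R x p by (intro mult_mono) auto
    then show ?thesis
      unfolding q_def bessel_shift_def R_def[symmetric]
      using abs_triangle_ineq[of "(s * R)\<^sup>2" "2 * s * R * sqrt x * snd p"]
      by (simp add: power_mult_distrib)
  qed
  have am: "2 * s * R * sqrt x \<le> s\<^sup>2 * R\<^sup>2 + x"
    using sum_squares_bound[of "s * R" "sqrt x"] x by (simp add: power_mult_distrib mult_ac)
  have ssR: "s\<^sup>2 * R\<^sup>2 \<le> s0\<^sup>2 * R\<^sup>2" using ss by (intro mult_right_mono) auto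
  have 1: "\<bar>q\<bar> \<le> x + ?d" using abs_q am ssR by linarith
  have "q\<^sup>2 \<le> (s\<^sup>2 * R\<^sup>2 + 2 * s * R * sqrt x)\<^sup>2"
    using abs_q power_mono[OF abs_q, of 2] by simp
  also have "\<dots> \<le> 2 * (s\<^sup>2 * R\<^sup>2)\<^sup>2 + 2 * (2 * s * R * sqrt x)\<^sup>2"
    using sum_squares_bound[of "s\<^sup>2 * R\<^sup>2" "2 * s * R * sqrt x"] by (simp add: power2_sum)
  also have "\<dots> = s\<^sup>2 * (2 * s\<^sup>2 * R ^ 4 + 8 * R\<^sup>2 * x)"
    using x by (simp add: power_mult_distrib algebra_simps power2_eq_square power4_eq_xxxx)
  also have "\<dots> \<le> s\<^sup>2 * (2 * s0\<^sup>2 * R ^ 4 * (1 + x) + 8 * R\<^sup>2 * (1 + x))"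
  proof (intro mult_left_mono add_mono)
    have "2 * s\<^sup>2 * R ^ 4 * 1 \<le> 2 * s0\<^sup>2 * R ^ 4 * (1 + x)"
      using ss x by (intro mult_mono) auto
    then show "2 * s\<^sup>2 * R ^ 4 \<le> 2 * s0\<^sup>2 * R ^ 4 * (1 + x)" by simp
  qed (use x in auto)
  finally have 2: "q\<^sup>2 \<le> ?e * (1 + x)" by (simp add: algebra_simps)
  let ?D = "(x + q) ^ L - x ^ L - L * x ^ (L - 1) * q"
  have "1 * \<bar>?D\<bar> \<le> (1 + x) * \<bar>?D\<bar>" using x by (intro mult_right_mono) auto
  also have "\<dots> \<le> ?e * L * (2 + ?d) ^ L * (1 + x) ^ L"
    using x 1 2 by (intro power_add_remainder) auto
  \<comment> \<open>Separates the radius from the constants: \<open>?e\<close> costs four powers of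
    \<open>1 + R\<close> and each factor \<open>2 + ?d\<close> two, in total
    \<open>4 + 2 * L\<close>.\<close>
  also have "\<dots> \<le> (s\<^sup>2 * ((2 * s0\<^sup>2 + 8) * (1 + R) ^ 4)) * L * ((2 + 2 * s0\<^sup>2) * (1 + R)\<^sup>2) ^ L * (1 + x) ^ L"
  proof -
    have "R\<^sup>2 \<le> (1 + R)\<^sup>2" "R ^ 4 \<le> (1 + R) ^ 4" "(1 + R)\<^sup>2 \<le> (1 + R) ^ 4" "1 \<le> (1 + R)\<^sup>2"
      using R by (auto intro!: power_mono power_increasing)
    then have *: "s0\<^sup>2 * R ^ 4 \<le> s0\<^sup>2 * (1 + R) ^ 4" "R\<^sup>2 \<le> (1 + R) ^ 4"
      "s0\<^sup>2 * R\<^sup>2 \<le> s0\<^sup>2 * (1 + R)\<^sup>2" "1 \<le> (1 + R)\<^sup>2"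
      by (auto intro: mult_left_mono)
    have E: "?e \<le> s\<^sup>2 * ((2 * s0\<^sup>2 + 8) * (1 + R) ^ 4)"
      using *(1,2) by (intro mult_left_mono) (auto simp: distrib_right)
    have D: "2 + ?d \<le> (2 + 2 * s0\<^sup>2) * (1 + R)\<^sup>2"
      using *(3,4) unfolding distrib_right by linarith
    show ?thesis
      by (rule mult_right_mono[OF mult_mono[OF mult_right_mono[OF E] power_mono[OF D]]])
        (use R x in auto)
  qed
  also have "\<dots> = s\<^sup>2 * ((2 * s0\<^sup>2 + 8) * L * (2 + 2 * s0\<^sup>2) ^ L) * (1 + R) ^ (4 + 2 * L) * (1 + x) ^ L"
    by (simp add: power_mult_distrib power_mult[symmetric] power_add mult_ac)
  finally show ?thesis by (simp add: q_def R_def)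
qed

lemma bessel_shift_power_integrable:
  assumes "k \<le> m" "0 \<le> s" "0 \<le> x"
  shows "integrable (mu k) (\<lambda>p. bessel_shift s x p ^ L)"
  by (rule S_integrable[where h = "\<lambda>w. w ^ L" and H = 1 and L = L])
    (use assms in \<open>auto intro!: continuous_intros\<close>)

text \<open>The leading 1 is the mass bound \<open>mu_mass_le\<close>. It makes the operator norm 1
  + O(s^2) instead of merely bounded.\<close>

lemma mu_weight_le:
  assumes k: "k \<le> m"
  shows "\<exists>K\<ge>0. \<forall>s x. 0 \<le> s \<longrightarrow> s \<le> s0 \<longrightarrow> 0 \<le> x \<longrightarrow>
    (\<integral>p. 1 + bessel_shift s x p ^ L \<partial>mu k) \<le> (1 + K * s\<^sup>2) * (1 + x ^ L)"
proof -
  interpret finite_measure "mu k" by (rule finite_measure_mu[OF k])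
  define r where "r = (\<integral>p. (fst p)\<^sup>2 \<partial>mu k)"
  define c where "c = (2 * s0\<^sup>2 + 8) * L * (2 + 2 * s0\<^sup>2) ^ L"
  define M where "M = (\<integral>p. (1 + fst p) ^ (4 + 2 * L) \<partial>mu k)"
  \<comment> \<open>\<open>L * r\<close> is the mean of the linear term, \<open>c * M\<close> the
    remainder, and \<open>2 ^ L\<close> the price of replacing \<open>(1 + x) ^ L\<close> by
    \<open>1 + x ^ L\<close>.\<close>
  define K where "K = L * r + c * M * 2 ^ L"
  have r: "0 \<le> r" by (simp add: r_def)
  have c: "0 \<le> c" by (simp add: c_def)
  have M: "0 \<le> M" unfolding M_def by (simp add: zero_le_even_power)
  have mass: "measure (mu k) UNIV \<le> 1" by (rule mu_mass_le[OF k])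
  have "(\<integral>p. 1 + bessel_shift s x p ^ L \<partial>mu k) \<le> (1 + K * s\<^sup>2) * (1 + x ^ L)"
    if s: "0 \<le> s" "s \<le> s0" and x: "0 \<le> x" for s x
  proof -
    note q = bessel_shift_mean[OF k x, of s]
    note mom = mu_moments[OF k, of "4 + 2 * L"]
    let ?g = "\<lambda>p. (1 + x ^ L) + L * x ^ (L - 1) * (bessel_shift s x p - x) +
      s\<^sup>2 * c * (1 + x) ^ L * (1 + fst p) ^ (4 + 2 * L)"
    have "(\<integral>p. 1 + bessel_shift s x p ^ L \<partial>mu k) \<le> (\<integral>p. ?g p \<partial>mu k)"
    proof (rule integral_mono_AE)
      show "integrable (mu k) (\<lambda>p. 1 + bessel_shift s x p ^ L)"
        using bessel_shift_power_integrable[OF k s(1) x] by simp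
      show "AE p in mu k. 1 + bessel_shift s x p ^ L \<le> ?g p"
        using AE_mu[OF k]
      proof eventually_elim
        case (elim p)
        then show ?case
          using bessel_shift_power_le[OF s x, of p L] by (simp add: c_def mult_ac)
      qed
      show "integrable (mu k) ?g"
        using q(1) mom by (intro Bochner_Integration.integrable_add integrable_mult_right) auto
    qed
    also have "\<dots> = measure (mu k) UNIV * (1 + x ^ L) + L * x ^ (L - 1) * (s\<^sup>2 * r) + s\<^sup>2 * c * (1 + x) ^ L * M"
      using q mom unfolding M_def r_def
      by (subst Bochner_Integration.integral_add, simp, simp, subst Bochner_Integration.integral_add) auto
    also have "\<dots> \<le> 1 * (1 + x ^ L) + L * (1 + x ^ L) * (s\<^sup>2 * r) + s\<^sup>2 * c * (2 ^ L * (1 + x ^ L)) * M"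
    proof (intro add_mono mult_right_mono mult_left_mono mass)
      show "x ^ (L - 1) \<le> 1 + x ^ L"
        using x power_increasing[of "L - 1" L x] power_le_one[of x "L - 1"]
        by (cases "x \<le> 1") (auto intro: add_increasing2 add_increasing)
      have "(1 + x) ^ L \<le> (2 * max 1 x) ^ L" using x by (intro power_mono) auto
      also have "\<dots> \<le> 2 ^ L * (1 + x ^ L)"
        using x by (cases "x \<le> 1") (auto simp: power_mult_distrib max_def)
      finally show "(1 + x) ^ L \<le> 2 ^ L * (1 + x ^ L)" .
    qed (use r c M x in auto)
    also have "\<dots> = (1 + K * s\<^sup>2) * (1 + x ^ L)" by (simp add: K_def algebra_simps)
    finally show ?thesis .
  qed
  moreover have "0 \<le> K" using r c M by (simp add: K_def)
  ultimately show ?thesis by blast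
qed

lemma S_bound:
  assumes k: "k \<le> m" and s: "0 \<le> s" and x: "0 \<le> x" and h_cont: "continuous_on UNIV h"
    and h_growth: "\<And>w. 0 \<le> w \<Longrightarrow> \<bar>h w\<bar> \<le> H * (1 + w ^ L)"
  shows "\<bar>S k s h x\<bar> \<le> H * (\<integral>p. 1 + bessel_shift s x p ^ L \<partial>mu k)"
proof -
  interpret finite_measure "mu k" by (rule finite_measure_mu[OF k])
  have int: "integrable (mu k) (\<lambda>p. H * (1 + bessel_shift s x p ^ L))"
    using bessel_shift_power_integrable[OF k s x] by simp
  have "\<bar>S k s h x\<bar> \<le> (\<integral>p. \<bar>h (bessel_shift s x p)\<bar> \<partial>mu k)"
    unfolding S_def by (rule integral_abs_bound)
  also have "\<dots> \<le> (\<integral>p. H * (1 + bessel_shift s x p ^ L) \<partial>mu k)"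
  proof (rule integral_mono_AE)
    show "integrable (mu k) (\<lambda>p. \<bar>h (bessel_shift s x p)\<bar>)"
      by (intro integrable_abs S_integrable[OF k s h_cont h_growth x])
    show "AE p in mu k. \<bar>h (bessel_shift s x p)\<bar> \<le> H * (1 + bessel_shift s x p ^ L)"
      using AE_mu[OF k] by eventually_elim (auto intro!: h_growth bessel_shift_nonneg x)
  qed fact
  finally show ?thesis by simp
qed

end

subsection \<open>Functions of polynomial growth\<close>

text \<open>The derivatives are an explicit family and \<open>H\<close> is any admissible bound, so
  that estimates can be composed without evaluating \<open>deriv_on\<close> or a supremum.
  \<open>Cpol_imp_jet\<close> and \<open>jet_imp_Cpol\<close> translate at both ends.\<close>

definition jet :: "nat \<Rightarrow> nat \<Rightarrow> real \<Rightarrow> (real \<Rightarrow> real) \<Rightarrow> (nat \<Rightarrow> real \<Rightarrow> real) \<Rightarrow> bool" where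
  "jet m L H f F \<longleftrightarrow>
    (\<forall>x\<ge>0. F 0 x = f x) \<and>
    (\<forall>j\<le>m. continuous_on {0..} (F j)) \<and>
    (\<forall>j<m. \<forall>x\<ge>0. (F j has_real_derivative F (Suc j) x) (at x within {0..})) \<and>
    (\<forall>j\<le>m. \<forall>x\<ge>0. \<bar>F j x\<bar> \<le> H * (1 + x ^ L))"

lemma jetD:
  assumes "jet m L H f F"
  shows "0 \<le> x \<Longrightarrow> F 0 x = f x"
    and "j \<le> m \<Longrightarrow> continuous_on {0..} (F j)"
    and "j < m \<Longrightarrow> 0 \<le> x \<Longrightarrow> (F j has_real_derivative F (Suc j) x) (at x within {0..})"
    and "j \<le> m \<Longrightarrow> 0 \<le> x \<Longrightarrow> \<bar>F j x\<bar> \<le> H * (1 + x ^ L)"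
  using assms unfolding jet_def by auto

lemma jet_nonneg: "jet m L H f F \<Longrightarrow> 0 \<le> H"
  using growth_const_nonneg[of "F 0" H L] by (auto simp: jet_def)

lemma jet_mono:
  assumes "jet m L H f F" "H \<le> H'"
  shows "jet m L H' f F"
proof -
  have "H * (1 + x ^ L) \<le> H' * (1 + x ^ L)" if "0 \<le> x" for x :: real
    using assms(2) that by (intro mult_right_mono) auto
  then have "\<bar>F j x\<bar> \<le> H' * (1 + x ^ L)" if "j \<le> m" "0 \<le> x" for j x
    using jetD(4)[OF assms(1) that] that(2) by (meson order_trans)
  then show ?thesis using assms(1) by (simp add: jet_def)
qed

lemma jet_cong:
  assumes "jet m L H f F" "\<And>x. 0 \<le> x \<Longrightarrow> f x = g x"
  shows "jet m L H g F"
  using assms unfolding jet_def by auto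

lemma at_within_atLeast_neq_bot: "0 \<le> x \<Longrightarrow> at x within {0::real..} \<noteq> bot"
proof -
  assume "0 \<le> x"
  then have "at x within {x<..} \<le> at x within {0..}" by (intro at_le) auto
  then show ?thesis using trivial_limit_at_right_real[of x] by (auto simp: bot_unique)
qed

lemma deriv_on_Suc: "deriv_on S (Suc j) f x = vector_derivative (deriv_on S j f) (at x within S)"
  by (simp add: deriv_on_def)

lemma deriv_on_atLeast_eq:
  assumes "j \<le> m" "0 \<le> x" "\<And>x. 0 \<le> x \<Longrightarrow> F 0 x = f x"
    and "\<And>j x. j < m \<Longrightarrow> 0 \<le> x \<Longrightarrow> (F j has_real_derivative F (Suc j) x) (at x within {0..})"
  shows "deriv_on {0..} j f x = F j x"
  using assms(1,2)
proof (induction j arbitrary: x)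
  case 0
  then show ?case using assms(3) by (simp add: deriv_on_def)
next
  case (Suc j)
  have "(F j has_vector_derivative F (Suc j) x) (at x within {0..})"
    using assms(4) Suc.prems by (simp add: has_real_derivative_iff_has_vector_derivative)
  then have "(deriv_on {0..} j f has_vector_derivative F (Suc j) x) (at x within {0..})"
    by (rule has_vector_derivative_transform[rotated 2]) (use Suc in auto)
  then show ?case
    unfolding deriv_on_Suc
    by (intro vector_derivative_within at_within_atLeast_neq_bot Suc.prems)
qed

lemma pol_norm_le_iff:
  assumes "f \<in> Cpol m L"
  shows "pol_norm m L f \<le> H \<longleftrightarrow> (\<forall>j\<le>m. \<forall>x\<ge>0. \<bar>deriv_on {0..} j f x\<bar> \<le> H * (1 + x ^ L))"
proof -
  have pos: "0 < 1 + x ^ L" if "0 \<le> x" for x :: real using that by (simp add: add_pos_nonneg)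
  have "pol_norm m L f \<le> H \<longleftrightarrow> (\<forall>j\<le>m. (SUP y\<in>{0..}. \<bar>deriv_on {0..} j f y\<bar> / (1 + y ^ L)) \<le> H)"
    unfolding pol_norm_def by (subst Max_le_iff) auto
  also have "\<dots> \<longleftrightarrow> (\<forall>j\<le>m. \<forall>x\<ge>0. \<bar>deriv_on {0..} j f x\<bar> / (1 + x ^ L) \<le> H)"
    using assms by (intro all_cong, subst cSUP_le_iff) (auto simp: Cpol_def)
  also have "\<dots> \<longleftrightarrow> (\<forall>j\<le>m. \<forall>x\<ge>0. \<bar>deriv_on {0..} j f x\<bar> \<le> H * (1 + x ^ L))"
    using pos by (auto simp: pos_divide_le_eq)
  finally show ?thesis .
qed

lemma jet_imp_Cpol:
  assumes "jet m L H f F"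
  shows "f \<in> Cpol m L" and "pol_norm m L f \<le> H"
proof -
  note F = jetD[OF assms]
  have eq: "deriv_on {0..} j f x = F j x" if "j \<le> m" "0 \<le> x" for j x
    using that F by (intro deriv_on_atLeast_eq) auto
  have "deriv_on {0..} j f differentiable_on {0..}" if j: "j < m" for j
    unfolding differentiable_on_def
  proof
    fix x :: real assume x: "x \<in> {0..}"
    have "(deriv_on {0..} j f has_real_derivative F (Suc j) x) (at x within {0..})"
      by (rule has_field_derivative_transform_within[OF F(3)[OF j], of x 1]) (use eq j x in auto)
    then show "deriv_on {0..} j f differentiable (at x within {0..})"
      by (rule has_field_derivative_imp_has_derivative[THEN differentiableI])
  qed
  moreover have "continuous_on {0..} (deriv_on {0..} j f)" if "j \<le> m" for j
    using continuous_on_cong[of "{0..}" "{0..}" "deriv_on {0..} j f" "F j"] F(2) eq that by simp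
  moreover have "bdd_above ((\<lambda>y. \<bar>deriv_on {0..} j f y\<bar> / (1 + y ^ L)) ` {0..})" if "j \<le> m" for j
    using F(4) eq that by (intro bdd_aboveI2[where M = H]) (auto simp: pos_divide_le_eq add_pos_nonneg)
  ultimately show *: "f \<in> Cpol m L"
    unfolding Cpol_def Ck_on_def by blast
  show "pol_norm m L f \<le> H"
    using F(4) eq by (subst pol_norm_le_iff[OF *]) auto
qed

lemma Ck_on_has_deriv:
  assumes "Ck_on m S f" "j < m" "x \<in> S" "at x within S \<noteq> bot"
  shows "(deriv_on S j f has_real_derivative deriv_on S (Suc j) f x) (at x within S)"
proof -
  have "deriv_on S j f differentiable (at x within S)"
    using assms by (auto simp: Ck_on_def differentiable_on_def)
  then show ?thesis
    unfolding deriv_on_Suc has_real_derivative_iff_has_vector_derivative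
    using vector_derivative_works by blast
qed

lemma Cpol_imp_jet:
  assumes "f \<in> Cpol m L"
  shows "jet m L (pol_norm m L f) f (\<lambda>j. deriv_on {0..} j f)"
proof -
  have Ck: "Ck_on m {0..} f" using assms by (simp add: Cpol_def)
  have "\<forall>x\<ge>0. deriv_on {0..} 0 f x = f x" by (simp add: deriv_on_def)
  moreover have "\<forall>j<m. \<forall>x\<ge>0. (deriv_on {0..} j f has_real_derivative deriv_on {0..} (Suc j) f x) (at x within {0..})"
    using Ck_on_has_deriv[OF Ck] at_within_atLeast_neq_bot by auto
  ultimately show ?thesis
    using Ck pol_norm_le_iff[OF assms, of "pol_norm m L f"] unfolding jet_def Ck_on_def by auto
qed

text \<open>The chain rule costs \<open>\<alpha> ^ j\<close>, at most \<open>A ^ m\<close>; the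
  weight costs \<open>A ^ L * (1 + \<beta>) ^ L\<close> by \<open>power_add_le_weight\<close>. A
  bound \<open>A\<close> of at least 1 treats contracting and expanding maps alike.\<close>

lemma jet_affine:
  assumes F: "jet m L H f F" and \<alpha>: "0 \<le> \<alpha>" "\<alpha> \<le> A" "1 \<le> A" and \<beta>: "0 \<le> \<beta>"
  shows "jet m L (H * (A ^ (m + L) * (1 + \<beta>) ^ L)) (\<lambda>y. f (\<alpha> * y + \<beta>)) (\<lambda>j y. \<alpha> ^ j * F j (\<alpha> * y + \<beta>))"
proof -
  note F' = jetD[OF F]
  have H: "0 \<le> H" using F by (rule jet_nonneg)
  have nn: "0 \<le> \<alpha> * y + \<beta>" if "0 \<le> y" for y using that \<alpha> \<beta> by simp
  have "\<bar>\<alpha> ^ j * F j (\<alpha> * y + \<beta>)\<bar> \<le> H * (A ^ (m + L) * (1 + \<beta>) ^ L) * (1 + y ^ L)"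
    if j: "j \<le> m" and y: "0 \<le> y" for j y
  proof -
    have "\<alpha> ^ j \<le> A ^ j" using \<alpha> by (intro power_mono) auto
    also have "\<dots> \<le> A ^ m" using \<alpha> j by (intro power_increasing) auto
    finally have 1: "\<alpha> ^ j \<le> A ^ m" .
    have "1 + (\<alpha> * y + \<beta>) ^ L \<le> 1 + (A * y + \<beta>) ^ L"
      using \<alpha> \<beta> y by (intro add_left_mono power_mono add_right_mono mult_right_mono) auto
    also have "\<dots> \<le> (1 + \<beta>) ^ L * (1 + (A * y) ^ L)"
      using \<alpha> \<beta> y by (intro power_add_le_weight) auto
    also have "\<dots> \<le> (1 + \<beta>) ^ L * (A ^ L * (1 + y ^ L))"
      using \<alpha> \<beta> y by (intro mult_left_mono) (auto simp: power_mult_distrib distrib_left)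
    finally have 2: "1 + (\<alpha> * y + \<beta>) ^ L \<le> (1 + \<beta>) ^ L * (A ^ L * (1 + y ^ L))" .
    have "\<bar>\<alpha> ^ j * F j (\<alpha> * y + \<beta>)\<bar> \<le> A ^ m * (H * (1 + (\<alpha> * y + \<beta>) ^ L))"
      unfolding abs_mult using 1 F'(4)[OF j nn[OF y]] \<alpha> by (intro mult_mono) auto
    also have "\<dots> \<le> A ^ m * (H * ((1 + \<beta>) ^ L * (A ^ L * (1 + y ^ L))))"
      using 2 H \<alpha> by (intro mult_left_mono) auto
    finally show ?thesis by (simp add: power_add mult_ac)
  qed
  moreover have "continuous_on {0..} (\<lambda>y. \<alpha> ^ j * F j (\<alpha> * y + \<beta>))" if "j \<le> m" for j
    by (intro continuous_intros continuous_on_compose2[OF F'(2)[OF that]]) (use nn in auto)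
  moreover have "((\<lambda>y. \<alpha> ^ j * F j (\<alpha> * y + \<beta>)) has_real_derivative \<alpha> ^ Suc j * F (Suc j) (\<alpha> * y + \<beta>)) (at y within {0..})"
    if j: "j < m" and y: "0 \<le> y" for j y
  proof -
    have "((\<lambda>y. \<alpha> * y + \<beta>) has_real_derivative \<alpha>) (at y within {0..})"
      by (auto intro!: derivative_eq_intros)
    then have "((\<lambda>y. F j (\<alpha> * y + \<beta>)) has_real_derivative F (Suc j) (\<alpha> * y + \<beta>) * \<alpha>) (at y within {0..})"
      by (rule has_real_derivative_compose_within[rotated, where T = "{0..}"]) (use F'(3)[OF j] nn y in auto)
    from DERIV_cmult[OF this, of "\<alpha> ^ j"] show ?thesis by (simp add: mult_ac)
  qed
  ultimately show ?thesis
    using F'(1) nn unfolding jet_def by auto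
qed

context radial_weights
begin

lemma jet_S:
  assumes F: "jet m L H f F" and s: "0 < s"
    and K: "\<And>k x. k \<le> m \<Longrightarrow> 0 \<le> x \<Longrightarrow> (\<integral>p. 1 + bessel_shift s x p ^ L \<partial>mu k) \<le> K * (1 + x ^ L)"
  shows "jet m L (H * K) (S 0 s (\<lambda>x. f (max 0 x))) (\<lambda>j. S j s (\<lambda>x. F j (max 0 x)))"
proof -
  note F' = jetD[OF F]
  have H: "0 \<le> H" using F by (rule jet_nonneg)
  \<comment> \<open>The averaging lemmas ask for continuity on the whole line. The constant
    extension to negative arguments provides it without changing any average, because shifted points
    are nonnegative.\<close>
  let ?F = "\<lambda>j x. F j (max 0 x)"
  have cont: "continuous_on UNIV (?F j)" if "j \<le> m" for j
    by (intro continuous_on_compose2[OF F'(2)[OF that]] continuous_intros) auto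
  have growth: "\<bar>?F j w\<bar> \<le> H * (1 + w ^ L)" if "j \<le> m" "0 \<le> w" for j w
    using F'(4) that by (simp add: max_def)
  have deriv: "(?F j has_real_derivative ?F (Suc j) w) (at w within {0..})" if "j < m" "0 \<le> w" for j w
    by (rule has_field_derivative_transform_within[of "F j" _ _ _ 1]) (use F'(3)[OF that] that in auto)
  have cS: "continuous_on {0..} (S j s (?F j))" if "j \<le> m" for j
    by (rule S_continuous[OF that _ cont growth]) (use s that in auto)
  have "(S j s (?F j) has_real_derivative S (Suc j) s (?F (Suc j)) x) (at x within {0..})"
    if j: "j < m" and x: "0 \<le> x" for j x
  \<comment> \<open>\<open>S_deriv\<close> needs a positive argument; the derivative at 0 follows
    from continuity of both averages up to 0.\<close>
  proof (rule has_real_derivative_within_atLeast[OF _ _ _ x])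
    show "(S j s (?F j) has_real_derivative S (Suc j) s (?F (Suc j)) y) (at y)" if "0 < y" for y
      by (rule S_deriv[OF j s that cont cont growth growth deriv]) (use j in auto)
  qed (use cS j in auto)
  moreover have "\<bar>S j s (?F j) x\<bar> \<le> H * K * (1 + x ^ L)" if j: "j \<le> m" and x: "0 \<le> x" for j x
  proof -
    have "\<bar>S j s (?F j) x\<bar> \<le> H * (\<integral>p. 1 + bessel_shift s x p ^ L \<partial>mu j)"
      by (rule S_bound[OF j _ x cont growth]) (use j s in auto)
    also have "\<dots> \<le> H * (K * (1 + x ^ L))"
      using K[OF j x] H by (intro mult_left_mono) auto
    finally show ?thesis by (simp add: mult_ac)
  qed
  moreover have "S 0 s (?F 0) x = S 0 s (\<lambda>x. f (max 0 x)) x" for x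
    using F'(1) by (simp add: S_def)
  ultimately show ?thesis
    using cS unfolding jet_def by auto
qed

lemma uniform_weight_bound:
  "\<exists>K\<ge>0. \<forall>k\<le>m. \<forall>s x. 0 \<le> s \<longrightarrow> s \<le> s0 \<longrightarrow> 0 \<le> x \<longrightarrow>
    (\<integral>p. 1 + bessel_shift s x p ^ L \<partial>mu k) \<le> (1 + K * s\<^sup>2) * (1 + x ^ L)"
proof -
  obtain K where K: "\<And>k. k \<le> m \<Longrightarrow> 0 \<le> K k" "\<And>k s x. k \<le> m \<Longrightarrow> 0 \<le> s \<Longrightarrow> s \<le> s0 \<Longrightarrow> 0 \<le> x \<Longrightarrow>
      (\<integral>p. 1 + bessel_shift s x p ^ L \<partial>mu k) \<le> (1 + K k * s\<^sup>2) * (1 + x ^ L)"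
    using mu_weight_le[of _ s0 L] by metis
  have "(1 + K k * s\<^sup>2) * (1 + x ^ L) \<le> (1 + sum K {..m} * s\<^sup>2) * (1 + x ^ L)"
    if "k \<le> m" "0 \<le> x" for k s x
    using that K(1) by (intro mult_right_mono add_left_mono member_le_sum) auto
  then show ?thesis
    using K by (intro exI[of _ "sum K {..m}"] conjI allI impI sum_nonneg) (auto intro: order_trans[OF K(2)])
qed

end

subsection \<open>Weights from the density\<close>

text \<open>
  For \<open>k \<ge> 1\<close> and \<open>\<eta> z = \<rho> (z\<^sup>2)\<close>, \<open>eta_weight \<eta> k z\<close> is a positive multiple of
  \<open>(- 1) ^ k * z ^ (2 * k) * (\<rho>^(k)) (z\<^sup>2)\<close>; the scaling makes the recursion below hold.
\<close>

definition eta_weight :: "(real \<Rightarrow> real) \<Rightarrow> nat \<Rightarrow> real \<Rightarrow> real" where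
  "eta_weight \<eta> k z = (if k = 0 then \<eta> z else fact (k - 1) / 2 ^ (k - 1) * eta_star \<eta> k z)"

lemma c_coeff_rec:
  assumes "1 \<le> j" "1 \<le> k"
  shows "c_coeff j (Suc k) = 2 / real k * ((real j - 2 * real k) * (if j \<le> k then c_coeff j k else 0) +
    (if 1 < j then c_coeff (j - 1) k else 0))"
proof -
  obtain l where l: "k = Suc l" using assms by (cases k) auto
  have *: "2 * real j / real (l + 1) - 4 = 2 / real (Suc l) * (real j - 2 * real (Suc l))"
    "j < l + 2 \<longleftrightarrow> j \<le> Suc l" "real (l + 1) = real (Suc l)"
    by (auto simp: field_simps)
  have "c_coeff j (Suc k) = (if j \<le> k then 2 / real k * (real j - 2 * real k) * c_coeff j k else 0) +
      (if 1 < j then 2 / real k * c_coeff (j - 1) k else 0)"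
    unfolding l c_coeff.simps(3) *(1) unfolding *(2,3) ..
  then show ?thesis by (simp add: distrib_left mult.assoc)
qed

text \<open>The operator z d/dz sends z^j eta^(j) to j z^j eta^(j) + z^(j+1) eta^(j+1). The
  recursion for \<open>c_coeff\<close> therefore says that the sum of order \<open>Suc k\<close> is
  2 / k times z d/dz - 2 k applied to the sum of order \<open>k\<close>; the alternating sign in
  \<open>eta_star\<close> reverses the difference.\<close>

lemma eta_star_deriv:
  assumes Ck: "Ck_on M UNIV \<eta>" and k: "1 \<le> k" "k < M"
  obtains D where "(eta_star \<eta> k has_real_derivative D) (at z)"
    and "eta_star \<eta> (Suc k) z = 2 / k * (2 * real k * eta_star \<eta> k z - z * D)"
proof
  let ?e = "\<lambda>j. deriv_on UNIV j \<eta>"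
  define D where "D = (- 1) ^ (k - 1) * (\<Sum>j=1..k. c_coeff j k * (real j * z ^ (j - 1) * ?e j z + z ^ j * ?e (Suc j) z))"
  have e: "(?e j has_real_derivative ?e (Suc j) z) (at z)" if "j < M" for j
    using Ck_on_has_deriv[OF Ck that, of z] by simp
  show "(eta_star \<eta> k has_real_derivative D) (at z)"
    unfolding eta_star_def[abs_def] D_def
    by (rule DERIV_cmult, rule DERIV_sum)
      (use k in \<open>auto intro!: derivative_eq_intros e simp: algebra_simps\<close>)
  let ?s = "(- 1 :: real) ^ (k - 1)"
  have zD: "z * D = ?s * (\<Sum>j=1..k. c_coeff j k * (j * z ^ j * ?e j z + z ^ Suc j * ?e (Suc j) z))"
  proof -
    have "z * (c_coeff j k * (real j * z ^ (j - 1) * ?e j z + z ^ j * ?e (Suc j) z)) =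
        c_coeff j k * (j * z ^ j * ?e j z + z ^ Suc j * ?e (Suc j) z)" for j
      by (cases j) (simp_all add: algebra_simps)
    then have "(\<Sum>j=1..k. z * (c_coeff j k * (real j * z ^ (j - 1) * ?e j z + z ^ j * ?e (Suc j) z))) =
        (\<Sum>j=1..k. c_coeff j k * (j * z ^ j * ?e j z + z ^ Suc j * ?e (Suc j) z))"
      by (rule sum.cong[OF refl])
    then show ?thesis
      unfolding D_def sum_distrib_left[symmetric] by (subst mult.left_commute) (simp only:)
  qed
  have shift: "(\<Sum>j=1..k. c_coeff j k * (z ^ Suc j * ?e (Suc j) z)) =
      (\<Sum>j=1..Suc k. (if 1 < j then c_coeff (j - 1) k else 0) * (z ^ j * ?e j z))"
  proof -
    have "(\<Sum>j=1..k. c_coeff j k * (z ^ Suc j * ?e (Suc j) z)) =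
        (\<Sum>j=Suc 1..Suc k. c_coeff (j - 1) k * (z ^ j * ?e j z))"
      by (subst sum.shift_bounds_cl_Suc_ivl) simp
    also have "\<dots> = (\<Sum>j=Suc 1..Suc k. (if 1 < j then c_coeff (j - 1) k else 0) * (z ^ j * ?e j z))"
      by (intro sum.cong) auto
    also have "\<dots> = (\<Sum>j=1..Suc k. (if 1 < j then c_coeff (j - 1) k else 0) * (z ^ j * ?e j z))"
      by (rule sum.mono_neutral_left) auto
    finally show ?thesis .
  qed
  have "(\<Sum>j=1..Suc k. c_coeff j (Suc k) * z ^ j * ?e j z) =
      2 / k * ((\<Sum>j=1..Suc k. (real j - 2 * real k) * (if j \<le> k then c_coeff j k else 0) * (z ^ j * ?e j z)) +
        (\<Sum>j=1..Suc k. (if 1 < j then c_coeff (j - 1) k else 0) * (z ^ j * ?e j z)))"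
    unfolding sum.distrib[symmetric] sum_distrib_left
    by (intro sum.cong refl) (simp only: c_coeff_rec[OF _ k(1)] atLeastAtMost_iff, simp add: algebra_simps)
  also have "(\<Sum>j=1..Suc k. (real j - 2 * real k) * (if j \<le> k then c_coeff j k else 0) * (z ^ j * ?e j z)) =
      (\<Sum>j=1..k. (real j - 2 * real k) * c_coeff j k * (z ^ j * ?e j z))"
    by simp
  finally have "(\<Sum>j=1..Suc k. c_coeff j (Suc k) * z ^ j * ?e j z) =
      - (2 / k * ((\<Sum>j=1..k. 2 * real k * (c_coeff j k * z ^ j * ?e j z)) -
        (\<Sum>j=1..k. c_coeff j k * (j * z ^ j * ?e j z + z ^ Suc j * ?e (Suc j) z))))"
    unfolding shift[symmetric]
    by (simp add: sum.distrib sum_subtractf sum_negf algebra_simps)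
  moreover have "(- 1 :: real) ^ (Suc k - 1) = - ?s" using k by (cases k) auto
  moreover have "(\<Sum>j=1..k. 2 * real k * (c_coeff j k * z ^ j * ?e j z)) =
      2 * real k * (\<Sum>j=1..k. c_coeff j k * z ^ j * ?e j z)"
    by (simp only: sum_distrib_left)
  moreover have "- s * - (2 / k * (2 * k * X - Y)) = 2 / k * (2 * k * (s * X) - s * Y)" for s X Y k :: real
    by (simp add: algebra_simps)
  ultimately show "eta_star \<eta> (Suc k) z = 2 / k * (2 * real k * eta_star \<eta> k z - z * D)"
    unfolding zD eta_star_def by (simp only:)
qed

lemma eta_weight_deriv:
  assumes Ck: "Ck_on M UNIV \<eta>" and k: "k < M"
  obtains D where "(eta_weight \<eta> k has_real_derivative D) (at z)"
    and "eta_weight \<eta> (Suc k) z = 2 * real k * eta_weight \<eta> k z - z * D"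
proof (cases k)
  case 0
  have "(deriv_on UNIV 0 \<eta> has_real_derivative deriv_on UNIV 1 \<eta> z) (at z)"
    using Ck_on_has_deriv[OF Ck, of 0 z] k by simp
  then show thesis
    using that[of "deriv_on UNIV 1 \<eta> z"]
    by (simp add: 0 eta_weight_def[abs_def] eta_star_def deriv_on_def)
next
  case (Suc l)
  obtain D where D: "(eta_star \<eta> k has_real_derivative D) (at z)"
    "eta_star \<eta> (Suc k) z = 2 / k * (2 * real k * eta_star \<eta> k z - z * D)"
    using eta_star_deriv[OF Ck _ k] Suc by auto
  show thesis
  proof (rule that)
    show "(eta_weight \<eta> k has_real_derivative fact (k - 1) / 2 ^ (k - 1) * D) (at z)"
    proof -
      have "eta_weight \<eta> k = (\<lambda>z. fact (k - 1) / 2 ^ (k - 1) * eta_star \<eta> k z)"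
        using Suc by (simp add: eta_weight_def fun_eq_iff)
      then show ?thesis using DERIV_cmult[OF D(1)] by metis
    qed
    \<comment> \<open>The factor of \<open>eta_weight\<close> is chosen to absorb the 2 / k of
      \<open>eta_star_deriv\<close>.\<close>
    have "fact k / 2 ^ k * (2 / k) = (fact (k - 1) / 2 ^ (k - 1) :: real)"
      unfolding Suc by (simp del: of_nat_Suc)
    then have "fact k / 2 ^ k * eta_star \<eta> (Suc k) z =
        fact (k - 1) / 2 ^ (k - 1) * (2 * real k * eta_star \<eta> k z - z * D)"
      unfolding D(2) by (simp only: mult.assoc[symmetric])
    then show "eta_weight \<eta> (Suc k) z = 2 * real k * eta_weight \<eta> k z - z * (fact (k - 1) / 2 ^ (k - 1) * D)"
      unfolding eta_weight_def using Suc
      by (simp only: right_diff_distrib mult.left_commute diff_Suc_1 nat.simps if_False)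
  qed
qed

lemma eta_weight_continuous:
  assumes Ck: "Ck_on M UNIV \<eta>" and k: "k \<le> M"
  shows "continuous_on UNIV (eta_weight \<eta> k)"
proof -
  have e: "continuous_on UNIV (deriv_on UNIV j \<eta>)" if "j \<le> M" for j
    using Ck that by (simp add: Ck_on_def)
  show ?thesis
  proof (cases "k = 0")
    case True
    then show ?thesis using e[of 0] by (simp add: eta_weight_def[abs_def] deriv_on_def)
  next
    case False
    then show ?thesis
      unfolding eta_weight_def[abs_def] eta_star_def using k
      by (auto intro!: continuous_intros e)
  qed
qed

lemma integral_lborel_fold:
  fixes f :: "real \<Rightarrow> real"
  assumes f: "integrable lborel f"
  shows "integrable lborel (\<lambda>x. indicator {0..} x * (f x + f (- x)))"
    and "(\<integral>x. f x \<partial>lborel) = (\<integral>x. indicator {0..} x * (f x + f (- x)) \<partial>lborel)"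
proof -
  have f': "integrable lborel (\<lambda>x. f (- x))"
    using lborel_integrable_real_affine[OF f, of "- 1" 0] by simp
  have pos: "integrable lborel (\<lambda>x. indicator {0..} x * f x)"
    "integrable lborel (\<lambda>x. indicator {0..} x * f (- x))"
    using integrable_mult_indicator[of "{0::real..}" lborel, OF _ f]
      integrable_mult_indicator[of "{0::real..}" lborel, OF _ f'] by auto
  have neg: "integrable lborel (\<lambda>x. indicator {..<0} x * f x)"
    using integrable_mult_indicator[of "{..<0::real}" lborel, OF _ f] by auto
  show "integrable lborel (\<lambda>x. indicator {0..} x * (f x + f (- x)))"
    using pos by (simp add: distrib_left)
  have "(\<integral>x. f x \<partial>lborel) = (\<integral>x. indicator {0..} x * f x + indicator {..<0} x * f x \<partial>lborel)"
    by (intro Bochner_Integration.integral_cong) (auto simp: indicator_def)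
  also have "\<dots> = (\<integral>x. indicator {0..} x * f x \<partial>lborel) + (\<integral>x. indicator {..<0} x * f x \<partial>lborel)"
    using pos neg by simp
  also have "(\<integral>x. indicator {..<0} x * f x \<partial>lborel) = (\<integral>x. indicator {..<0} (- x) * f (- x) \<partial>lborel)"
    using lborel_integral_real_affine[of "- 1" "\<lambda>x. indicator {..<0} x * f x" 0] by simp
  also have "\<dots> = (\<integral>x. indicator {0..} x * f (- x) \<partial>lborel)"
  proof (rule integral_cong_AE)
    show "AE x in lborel. indicator {..<0} (- x) * f (- x) = indicator {0..} x * f (- x)"
      using AE_lborel_singleton[of 0] by eventually_elim (auto simp: indicator_def)
    show "(\<lambda>x. indicator {..<0} (- x) * f (- x)) \<in> borel_measurable lborel"
      "(\<lambda>x. indicator {0..} x * f (- x)) \<in> borel_measurable lborel"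
      using f' by (auto intro!: borel_measurable_times)
  qed
  finally show "(\<integral>x. f x \<partial>lborel) = (\<integral>x. indicator {0..} x * (f x + f (- x)) \<partial>lborel)"
    using pos by (simp add: distrib_left)
qed

text \<open>Symmetry is assumed for the law of \<open>Z\<close>, not pointwise for the density.
  Averaging over R and - R gives even weights directly, and it preserves the recursion because z
  d/dz commutes with reflection.\<close>

definition sym_weight :: "(real \<Rightarrow> real) \<Rightarrow> nat \<Rightarrow> real \<Rightarrow> real" where
  "sym_weight \<eta> k R = (eta_weight \<eta> k R + eta_weight \<eta> k (- R)) / 2"

locale symmetric_density = prob_space P for P :: "'w measure" +
  fixes Z :: "'w \<Rightarrow> real" and \<eta> :: "real \<Rightarrow> real" and M :: nat
  assumes density: "distributed P lborel Z (\<lambda>z. ennreal (\<eta> z))" and nonneg: "\<And>z. 0 \<le> \<eta> z"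
    and symmetric: "distr P borel (\<lambda>\<omega>. - Z \<omega>) = distr P borel Z"
    and moments: "\<And>k::nat. integrable P (\<lambda>\<omega>. \<bar>Z \<omega>\<bar> ^ k)"
    and smooth: "Ck_on M UNIV \<eta>"
    and eta_star_nonneg: "\<And>k z. 1 \<le> k \<Longrightarrow> k \<le> M \<Longrightarrow> 0 \<le> eta_star \<eta> k z"
begin

lemma Z_measurable [measurable]: "Z \<in> borel_measurable P"
  using distributed_measurable[OF density] by simp

lemma integral_Z_fold:
  fixes \<phi> :: "real \<Rightarrow> real"
  assumes [measurable]: "\<phi> \<in> borel_measurable borel" and int: "integrable P (\<lambda>\<omega>. \<phi> (Z \<omega>))"
  shows "(\<integral>\<omega>. \<phi> (Z \<omega>) \<partial>P) = (\<integral>R. indicator {0..} R * (sym_weight \<eta> 0 R * (\<phi> R + \<phi> (- R))) \<partial>lborel)"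
    and "integrable lborel (\<lambda>R. indicator {0..} R * (sym_weight \<eta> 0 R * (\<phi> R + \<phi> (- R))))"
proof -
  have int': "integrable P (\<lambda>\<omega>. \<phi> (- Z \<omega>))"
    and eq: "(\<integral>\<omega>. \<phi> (- Z \<omega>) \<partial>P) = (\<integral>\<omega>. \<phi> (Z \<omega>) \<partial>P)"
    using int integrable_distr_eq[of "\<lambda>\<omega>. - Z \<omega>" P borel \<phi>] integrable_distr_eq[of Z P borel \<phi>]
      integral_distr[of "\<lambda>\<omega>. - Z \<omega>" P borel \<phi>] integral_distr[of Z P borel \<phi>]
    by (simp_all add: symmetric)
  \<comment> \<open>Once the test function is even, folding the integral at 0 involves the density
    only through \<open>\<eta> R + \<eta> (- R)\<close>.\<close>
  let ?\<psi> = "\<lambda>z. \<phi> z + \<phi> (- z)"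
  have \<psi>: "integrable lborel (\<lambda>z. \<eta> z * ?\<psi> z)"
    using distributed_integrable[OF density, of ?\<psi>] nonneg int int' by simp
  have W: "indicator {0..} R * (\<eta> R * ?\<psi> R + \<eta> (- R) * ?\<psi> (- R)) =
      2 * (indicator {0..} R * (sym_weight \<eta> 0 R * ?\<psi> R))" for R
    by (simp add: sym_weight_def eta_weight_def algebra_simps)
  have "2 * (\<integral>\<omega>. \<phi> (Z \<omega>) \<partial>P) = (\<integral>\<omega>. ?\<psi> (Z \<omega>) \<partial>P)"
    using int int' eq by simp
  also have "\<dots> = (\<integral>z. \<eta> z * ?\<psi> z \<partial>lborel)"
    using distributed_integral[OF density, of ?\<psi>] nonneg by simp
  also have "\<dots> = (\<integral>R. indicator {0..} R * (\<eta> R * ?\<psi> R + \<eta> (- R) * ?\<psi> (- R)) \<partial>lborel)"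
    by (rule integral_lborel_fold(2)[OF \<psi>])
  finally show "(\<integral>\<omega>. \<phi> (Z \<omega>) \<partial>P) = (\<integral>R. indicator {0..} R * (sym_weight \<eta> 0 R * (\<phi> R + \<phi> (- R))) \<partial>lborel)"
    unfolding W by simp
  show "integrable lborel (\<lambda>R. indicator {0..} R * (sym_weight \<eta> 0 R * (\<phi> R + \<phi> (- R))))"
    using integral_lborel_fold(1)[OF \<psi>] unfolding W by simp
qed

lemma radial_weights: "radial_weights (sym_weight \<eta>) M"
proof
  fix k assume k: "k \<le> M"
  show "continuous_on UNIV (sym_weight \<eta> k)"
    unfolding sym_weight_def[abs_def]
    by (intro continuous_intros continuous_on_compose2[OF eta_weight_continuous[OF smooth k]]) auto
  show "0 \<le> sym_weight \<eta> k R" for R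
    using k nonneg eta_star_nonneg[of k] by (auto simp: sym_weight_def eta_weight_def intro!: mult_nonneg_nonneg add_nonneg_nonneg)
next
  fix k :: nat and R :: real assume k: "k < M"
  obtain D E where D: "(eta_weight \<eta> k has_real_derivative D) (at R)"
      "eta_weight \<eta> (Suc k) R = 2 * real k * eta_weight \<eta> k R - R * D"
    and E: "(eta_weight \<eta> k has_real_derivative E) (at (- R))"
      "eta_weight \<eta> (Suc k) (- R) = 2 * real k * eta_weight \<eta> k (- R) - (- R) * E"
    using eta_weight_deriv[OF smooth k] by metis
  have "((\<lambda>R. eta_weight \<eta> k (- R)) has_real_derivative E * - 1) (at R)"
    by (rule DERIV_chain2[where f = "eta_weight \<eta> k" and g = uminus, OF E(1)])
      (auto intro!: derivative_eq_intros)
  then have "(sym_weight \<eta> k has_real_derivative (D + E * - 1) / 2) (at R)"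
    unfolding sym_weight_def[abs_def] by (intro DERIV_cdivide DERIV_add D(1))
  moreover have "sym_weight \<eta> (Suc k) R = 2 * real k * sym_weight \<eta> k R - R * ((D + E * - 1) / 2)"
    by (simp add: sym_weight_def D(2) E(2) field_simps)
  ultimately show "\<exists>D. (sym_weight \<eta> k has_real_derivative D) (at R) \<and>
      sym_weight \<eta> (Suc k) R = 2 * real k * sym_weight \<eta> k R - R * D"
    by blast
next
  fix j
  have "(\<lambda>R. indicator {0..} R * (sym_weight \<eta> 0 R * (\<bar>R\<bar> ^ j + \<bar>- R\<bar> ^ j))) =
      (\<lambda>R. 2 * (indicator {0..} R * (sym_weight \<eta> 0 R * R ^ j)))"
    by (auto simp: indicator_def)
  then show "integrable lborel (\<lambda>R. indicator {0..} R * (sym_weight \<eta> 0 R * R ^ j))"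
    using integral_Z_fold(2)[of "\<lambda>z. \<bar>z\<bar> ^ j"] moments[of j] by simp
next
  show "(\<integral>R. indicator {0..} R * sym_weight \<eta> 0 R \<partial>lborel) = 1 / 2"
  proof -
    have "(\<integral>R. 2 * (indicator {0..} R * sym_weight \<eta> 0 R) \<partial>lborel) =
        (\<integral>R. indicator {0..} R * (sym_weight \<eta> 0 R * (1 + 1)) \<partial>lborel)"
      by (intro Bochner_Integration.integral_cong) auto
    also have "\<dots> = (\<integral>\<omega>. 1 \<partial>P)"
      by (rule integral_Z_fold(1)[symmetric]) auto
    finally have "2 * (\<integral>R. indicator {0..} R * sym_weight \<eta> 0 R \<partial>lborel) = 1"
      by (simp add: prob_space)
    then show ?thesis by simp
  qed
qed

end

subsection \<open>The scheme\<close>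

lemma psi_nonneg: "0 \<le> u \<Longrightarrow> 0 \<le> psi b u"
  by (cases "0 < b") (auto simp: psi_def divide_nonneg_pos mult_nonneg_nonneg mult_nonpos_nonneg intro!: divide_nonpos_neg)

text \<open>\<open>psi b u\<close> is the integral of \<open>exp (- b * v)\<close> over
  \<open>v\<close> from 0 to \<open>u\<close>, and the integrand is at most
  \<open>exp (\<bar>b\<bar> * u)\<close>.\<close>

lemma psi_le:
  assumes "0 \<le> u"
  shows "psi b u \<le> u * exp (\<bar>b\<bar> * u)"
proof -
  have 1: "psi b u \<le> u" if "0 < b"
    using that exp_ge_add_one_self[of "- b * u"] by (simp add: psi_def pos_divide_le_eq mult.commute)
  have 2: "u \<le> u * exp (\<bar>b\<bar> * u)" using assms by (simp add: mult_le_cancel_left1)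
  have 3: "psi b u \<le> u * exp (\<bar>b\<bar> * u)" if "b < 0"
  proof -
    have "1 - exp (- b * u) \<ge> b * u * exp (- b * u)"
      using mult_left_mono[OF exp_ge_add_one_self[of "b * u"], of "exp (- b * u)"]
      by (simp add: exp_add[symmetric] algebra_simps)
    then show ?thesis using that by (simp add: psi_def neg_divide_le_eq mult_ac)
  qed
  show ?thesis using 1 2 3 by (cases b "0::real" rule: linorder_cases) (auto simp: psi_def)
qed

context symmetric_density
begin

interpretation radial_weights "sym_weight \<eta>" M
  by (rule radial_weights)

text \<open>\<open>nu 0\<close> sums over the two signs of Z, and at these coordinates the shift is
  the square of sqrt x + s R or sqrt x - s R. Folding the density at 0 supplies the radius.\<close>

lemma expectation_eq_S:
  fixes g :: "real \<Rightarrow> real"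
  assumes x: "0 \<le> x" and s: "0 \<le> s" and g_cont: "continuous_on UNIV g"
    and growth: "\<And>w. 0 \<le> w \<Longrightarrow> \<bar>g w\<bar> \<le> H * (1 + w ^ L)"
  shows "(\<integral>\<omega>. g ((sqrt x + s * Z \<omega>)\<^sup>2) \<partial>P) = S 0 s g x"
proof -
  have [measurable]: "g \<in> borel_measurable borel"
    using g_cont by (rule borel_measurable_continuous_onI)
  let ?\<phi> = "\<lambda>z. g ((sqrt x + s * z)\<^sup>2)"
  have H: "0 \<le> H" using growth by (rule growth_const_nonneg)
  have int: "integrable P (\<lambda>\<omega>. ?\<phi> (Z \<omega>))"
  proof (rule Bochner_Integration.integrable_bound)
    show "integrable P (\<lambda>\<omega>. H * (1 + (sqrt x + s * \<bar>Z \<omega>\<bar>) ^ (2 * L)))"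
      unfolding binomial_ring power_mult_distrib
      by (intro integrable_mult_right Bochner_Integration.integrable_add Bochner_Integration.integrable_sum
          moments integrable_const)
    show "AE \<omega> in P. norm (?\<phi> (Z \<omega>)) \<le> norm (H * (1 + (sqrt x + s * \<bar>Z \<omega>\<bar>) ^ (2 * L)))"
    proof (intro AE_I2)
      fix \<omega>
      have "\<bar>sqrt x + s * Z \<omega>\<bar> \<le> sqrt x + s * \<bar>Z \<omega>\<bar>"
        using x s abs_triangle_ineq[of "sqrt x" "s * Z \<omega>"] by (simp add: abs_mult)
      then have "\<bar>sqrt x + s * Z \<omega>\<bar> ^ (2 * L) \<le> (sqrt x + s * \<bar>Z \<omega>\<bar>) ^ (2 * L)"
        by (intro power_mono) auto
      then have "((sqrt x + s * Z \<omega>)\<^sup>2) ^ L \<le> (sqrt x + s * \<bar>Z \<omega>\<bar>) ^ (2 * L)"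
        by (simp add: power_mult)
      then have "\<bar>?\<phi> (Z \<omega>)\<bar> \<le> H * (1 + (sqrt x + s * \<bar>Z \<omega>\<bar>) ^ (2 * L))"
        using growth[of "(sqrt x + s * Z \<omega>)\<^sup>2"] H by (auto elim!: order_trans intro!: mult_left_mono)
      then show "norm (?\<phi> (Z \<omega>)) \<le> norm (H * (1 + (sqrt x + s * \<bar>Z \<omega>\<bar>) ^ (2 * L)))"
        unfolding real_norm_def by linarith
    qed
  qed measurable
  have nu0: "(\<integral>y. g (bessel_shift s x (R, y)) \<partial>nu 0) = ?\<phi> R + ?\<phi> (- R)" for R
  proof -
    have "continuous_on UNIV (\<lambda>y. g (bessel_shift s x (R, y)))"
      by (intro continuous_on_compose2[OF g_cont] continuous_intros) auto
    moreover have "bessel_shift s x (R, 1) = (sqrt x + s * R)\<^sup>2"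
      "bessel_shift s x (R, - 1) = (sqrt x + s * - R)\<^sup>2"
      using x by (simp_all add: bessel_shift_def power2_eq_square algebra_simps)
    ultimately show ?thesis
      by (subst nu_0_integral) (simp_all add: borel_measurable_continuous_onI)
  qed
  have "S 0 s g x = (\<integral>R. indicator {0..} R * (sym_weight \<eta> 0 R *
      (\<integral>y. g (bessel_shift s x (R, y)) \<partial>nu 0)) \<partial>lborel)"
    unfolding S_def
    by (rule mu_section_integrable(2)[symmetric, OF le0 S_integrable[OF le0 s g_cont growth x]])
  also have "\<dots> = (\<integral>\<omega>. ?\<phi> (Z \<omega>) \<partial>P)"
    unfolding nu0 using integral_Z_fold(1)[OF _ int] by simp
  finally show ?thesis by (rule sym)
qed

text \<open>\<open>Yhat\<close> applies the same affine map before and after x -> (sqrt x + s Z)^2,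
  so the operator is \<open>S 0 s\<close> between two affine compositions. The constant
  \<open>\<kappa>\<close> is uniform in \<open>t\<close>, \<open>f\<close> and the bound
  \<open>H\<close>, which is what iteration requires.\<close>

lemma jet_Qop_step:
  assumes \<sigma>: "0 < \<sigma>" "\<sigma>\<^sup>2 \<le> 4 * a" and T: "0 < T" and m: "m \<le> M"
  shows "\<exists>\<kappa>\<ge>0. \<forall>t H f F. 0 < t \<longrightarrow> t \<le> T \<longrightarrow> jet m L H f F \<longrightarrow>
    (\<exists>G. jet m L (H * exp (\<kappa> * t)) (Qop P Z a b \<sigma> t f) G)"
proof -
  \<comment> \<open>Lowering the order from \<open>M\<close> to \<open>m\<close> leaves
    \<open>mu\<close> and \<open>S\<close> unchanged, since they are built from the weights
    alone.\<close>
  interpret m: radial_weights "sym_weight \<eta>" m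
    using radial_weights m unfolding radial_weights_def by auto
  \<comment> \<open>The largest noise coefficient for \<open>t \<le> T\<close>; it makes
    \<open>K\<close> independent of \<open>t\<close>.\<close>
  define s0 where "s0 = \<sigma> * sqrt T / 2"
  obtain K where K: "0 \<le> K" "\<And>k s x. k \<le> m \<Longrightarrow> 0 \<le> s \<Longrightarrow> s \<le> s0 \<Longrightarrow> 0 \<le> x \<Longrightarrow>
      (\<integral>p. 1 + bessel_shift s x p ^ L \<partial>mu k) \<le> (1 + K * s\<^sup>2) * (1 + x ^ L)"
    using m.uniform_weight_bound[of s0 L] by blast
  define a' where "a' = a - \<sigma>\<^sup>2 / 4"
  have a': "0 \<le> a'" using \<sigma> by (simp add: a'_def)
  define c where "c = exp (\<bar>b\<bar> * T) * a'"
  have c: "0 \<le> c" using a' by (simp add: c_def)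
  \<comment> \<open>\<open>d * t\<close> bounds the logarithm of the cost of one affine map:
    \<open>(m + L) * \<bar>b\<bar>\<close> from the slope, \<open>L * c\<close> from the offset,
    which is at most \<open>c * t\<close>. In \<open>\<kappa>\<close> it counts twice, and
    \<open>K * \<sigma>\<^sup>2\<close> covers the average because s^2 = sigma^2 t / 4.\<close>
  define d where "d = (m + L) * \<bar>b\<bar> + L * c"
  have d: "0 \<le> d" using c by (simp add: d_def)
  define \<kappa> where "\<kappa> = 2 * d + K * \<sigma>\<^sup>2"
  have "\<exists>G. jet m L (H * exp (\<kappa> * t)) (Qop P Z a b \<sigma> t f) G"
    if t: "0 < t" "t \<le> T" and F: "jet m L H f F" for t H f F
  proof -
    define \<alpha> \<beta> s where "\<alpha> = exp (- b * t / 2)" and "\<beta> = psi b (t / 2) * a'" and "s = \<sigma> * sqrt t / 2"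
    define A where "A = exp (\<bar>b\<bar> * t)"
    have \<alpha>: "0 \<le> \<alpha>" "\<alpha> \<le> A" "1 \<le> A"
    proof -
      have "- b * t \<le> \<bar>b\<bar> * t" "0 \<le> \<bar>b\<bar> * t"
        using t by (intro mult_right_mono mult_nonneg_nonneg; simp)+
      then have "- b * t / 2 \<le> \<bar>b\<bar> * t" by linarith
      then show "\<alpha> \<le> A" unfolding \<alpha>_def A_def exp_le_cancel_iff .
    qed (use t in \<open>auto simp: \<alpha>_def A_def\<close>)
    have \<beta>: "0 \<le> \<beta>" using t a' psi_nonneg by (simp add: \<beta>_def)
    have "psi b (t / 2) \<le> (t / 2) * exp (\<bar>b\<bar> * (t / 2))" using t by (intro psi_le) auto
    also have "\<dots> \<le> t * exp (\<bar>b\<bar> * T)"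
    proof (intro mult_mono)
      show "exp (\<bar>b\<bar> * (t / 2)) \<le> exp (\<bar>b\<bar> * T)"
        unfolding exp_le_cancel_iff using t by (intro mult_left_mono) auto
    qed (use t in auto)
    finally have "\<beta> \<le> c * t"
      unfolding \<beta>_def c_def using a' by (simp add: mult_left_mono mult_ac)
    then have \<beta>': "1 + \<beta> \<le> exp (c * t)" using exp_ge_add_one_self[of "c * t"] by linarith
    have affine: "A ^ (m + L) * (1 + \<beta>) ^ L \<le> exp (d * t)"
    proof -
      have "A ^ (m + L) * (1 + \<beta>) ^ L \<le> A ^ (m + L) * exp (c * t) ^ L"
        using \<beta> \<beta>' \<alpha> by (intro mult_left_mono power_mono) auto
      also have "\<dots> = exp (d * t)"
        by (simp add: A_def d_def exp_of_nat_mult[symmetric] exp_add[symmetric] algebra_simps)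
      finally show ?thesis .
    qed
    have s: "0 < s" "s \<le> s0" using \<sigma> t by (auto simp: s_def s0_def)
    let ?f = "\<lambda>y. f (\<alpha> * y + \<beta>)" and ?F = "\<lambda>j y. \<alpha> ^ j * F j (\<alpha> * y + \<beta>)"
    let ?H = "H * (A ^ (m + L) * (1 + \<beta>) ^ L)"
    have 1: "jet m L ?H ?f ?F" by (rule jet_affine[OF F \<alpha> \<beta>])
    obtain G where G: "jet m L (?H * (1 + K * s\<^sup>2)) (S 0 s (\<lambda>x. ?f (max 0 x))) G"
      using m.jet_S[OF 1 s(1) K(2)] s by auto
    from jet_affine[OF G \<alpha> \<beta>]
    have "jet m L (?H * (1 + K * s\<^sup>2) * (A ^ (m + L) * (1 + \<beta>) ^ L))
        (\<lambda>y. S 0 s (\<lambda>x. ?f (max 0 x)) (\<alpha> * y + \<beta>)) (\<lambda>j y. \<alpha> ^ j * G j (\<alpha> * y + \<beta>))" .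
    moreover have "?H * (1 + K * s\<^sup>2) * (A ^ (m + L) * (1 + \<beta>) ^ L) \<le> H * exp (\<kappa> * t)"
    proof -
      have "1 + K * s\<^sup>2 \<le> exp (K * s\<^sup>2)" by (rule exp_ge_add_one_self)
      also have "\<dots> \<le> exp (K * \<sigma>\<^sup>2 * t)"
        using K(1) t by (simp add: s_def power_mult_distrib power_divide mult_left_mono)
      finally have "H * ((A ^ (m + L) * (1 + \<beta>) ^ L) * (1 + K * s\<^sup>2) * (A ^ (m + L) * (1 + \<beta>) ^ L)) \<le>
          H * (exp (d * t) * exp (K * \<sigma>\<^sup>2 * t) * exp (d * t))"
        using affine jet_nonneg[OF F] K(1) \<alpha> \<beta> by (intro mult_left_mono mult_mono) auto
      also have "\<dots> = H * exp (\<kappa> * t)"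
        by (simp add: exp_add[symmetric] \<kappa>_def algebra_simps)
      finally show ?thesis by (simp add: mult_ac)
    qed
    ultimately have "jet m L (H * exp (\<kappa> * t)) (\<lambda>y. S 0 s (\<lambda>x. ?f (max 0 x)) (\<alpha> * y + \<beta>))
        (\<lambda>j y. \<alpha> ^ j * G j (\<alpha> * y + \<beta>))"
      by (rule jet_mono)
    moreover have "S 0 s (\<lambda>x. ?f (max 0 x)) (\<alpha> * y + \<beta>) = Qop P Z a b \<sigma> t f y" if y: "0 \<le> y" for y
    proof -
      \<comment> \<open>Continuity is known for \<open>?F 0\<close>, so the expectation formula is
        applied to it and then carried over to \<open>?f\<close>, with which it agrees on
        nonnegative arguments.\<close>
      have cont: "continuous_on UNIV (\<lambda>x. ?F 0 (max 0 x))"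
        by (intro continuous_on_compose2[OF jetD(2)[OF 1 le0]] continuous_intros) auto
      have eq: "?F 0 (max 0 x) = ?f (max 0 x)" for x
        using jetD(1)[OF 1, of "max 0 x"] by simp
      have growth: "\<bar>?F 0 (max 0 w)\<bar> \<le> ?H * (1 + w ^ L)" if "0 \<le> w" for w
        using jetD(4)[OF 1 le0 that] that by (simp add: max_def)
      have "S 0 s (\<lambda>x. ?F 0 (max 0 x)) (\<alpha> * y + \<beta>) =
          (\<integral>\<omega>. ?F 0 (max 0 ((sqrt (\<alpha> * y + \<beta>) + s * Z \<omega>)\<^sup>2)) \<partial>P)"
        by (rule expectation_eq_S[symmetric, OF _ _ cont growth]) (use \<alpha> \<beta> y s in auto)
      then have "S 0 s (\<lambda>x. ?f (max 0 x)) (\<alpha> * y + \<beta>) =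
          (\<integral>\<omega>. ?f (max 0 ((sqrt (\<alpha> * y + \<beta>) + s * Z \<omega>)\<^sup>2)) \<partial>P)"
        unfolding eq .
      then show ?thesis
        by (simp add: Qop_def Yhat_def \<alpha>_def \<beta>_def s_def a'_def)
    qed
    ultimately show ?thesis using jet_cong by blast
  qed
  moreover have "0 \<le> \<kappa>" using d K(1) by (simp add: \<kappa>_def)
  ultimately show ?thesis by blast
qed

end

theorem proposition1p2p4:
  fixes P :: "'w measure" and Z :: "'w \<Rightarrow> real" and \<eta> :: "real \<Rightarrow> real"
    and a b \<sigma> T :: real and L m M n :: nat
  assumes "\<sigma> > 0" and "a \<ge> 0" and "\<sigma>\<^sup>2 \<le> 4 * a" and "T > 0" and "m \<le> M" and "n \<ge> 1"
    and "prob_space P"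
    and density: "distributed P lborel Z (\<lambda>z. ennreal (\<eta> z))" "\<And>z. \<eta> z \<ge> 0"
    and symmetric: "distr P borel (\<lambda>\<omega>. - Z \<omega>) = distr P borel Z"
    and moments: "\<And>k::nat. integrable P (\<lambda>\<omega>. \<bar>Z \<omega>\<bar> ^ k)"
      "(\<integral>\<omega>. Z \<omega> ^ 2 \<partial>P) = 1" "(\<integral>\<omega>. Z \<omega> ^ 4 \<partial>P) = 3"
    and smooth: "Ck_on M UNIV \<eta>"
    and decay: "\<And>i. i \<le> M \<Longrightarrow>
      (\<lambda>z. \<bar>deriv_on UNIV i \<eta> z\<bar>) \<in> o[at_infinity](\<lambda>z. 1 / \<bar>z\<bar> ^ (2 * L + i))"
    and eta_star_nonneg: "\<And>m' z. 1 \<le> m' \<Longrightarrow> m' \<le> M \<Longrightarrow> eta_star \<eta> m' z \<ge> 0"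
  shows "\<exists>C\<ge>0. \<forall>f\<in>Cpol m L. \<forall>l::nat.
     (\<forall>j\<le>n ^ l. (Qop P Z a b \<sigma> (T / real n ^ l) ^^ j) f \<in> Cpol m L) \<and>
     (MAX j\<in>{0..n ^ l}. pol_norm m L ((Qop P Z a b \<sigma> (T / real n ^ l) ^^ j) f))
       \<le> C * pol_norm m L f"
proof -
  interpret prob_space P by fact
  interpret symmetric_density P Z \<eta> M
    by unfold_locales (fact density symmetric moments smooth eta_star_nonneg)+
  obtain \<kappa> where \<kappa>: "0 \<le> \<kappa>" and step: "\<And>t H f F. 0 < t \<Longrightarrow> t \<le> T \<Longrightarrow> jet m L H f F \<Longrightarrow>
      \<exists>G. jet m L (H * exp (\<kappa> * t)) (Qop P Z a b \<sigma> t f) G"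
    using jet_Qop_step[OF \<open>\<sigma> > 0\<close> \<open>\<sigma>\<^sup>2 \<le> 4 * a\<close> \<open>T > 0\<close> \<open>m \<le> M\<close>, of L b] by blast
  have main: "(Qop P Z a b \<sigma> (T / real n ^ l) ^^ j) f \<in> Cpol m L"
    "pol_norm m L ((Qop P Z a b \<sigma> (T / real n ^ l) ^^ j) f) \<le> exp (\<kappa> * T) * pol_norm m L f"
    if f: "f \<in> Cpol m L" and j: "j \<le> n ^ l" for f l j
  proof -
    define t where "t = T / real n ^ l"
    have n: "1 \<le> real n ^ l" using \<open>n \<ge> 1\<close> by simp
    have t: "0 < t" "t \<le> T"
    proof -
      have pos: "0 < real n ^ l" using n by linarith
      then show "0 < t" using \<open>T > 0\<close> unfolding t_def by (rule divide_pos_pos[rotated])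
      show "t \<le> T"
        using pos n \<open>T > 0\<close> mult_left_mono[of 1 "real n ^ l" T] by (simp add: t_def pos_divide_le_eq)
    qed
    have H: "0 \<le> pol_norm m L f" using Cpol_imp_jet[OF f] by (rule jet_nonneg)
    \<comment> \<open>The number of iterations enters only through the elapsed time
      \<open>j * t\<close>. It never exceeds \<open>T\<close>, so the final constant does not depend
      on \<open>l\<close>.\<close>
    have "\<exists>F. jet m L (pol_norm m L f * exp (\<kappa> * (j * t))) ((Qop P Z a b \<sigma> t ^^ j) f) F"
    proof (induction j)
      case 0
      then show ?case using Cpol_imp_jet[OF f] by auto
    next
      case (Suc j)
      then obtain F where "jet m L (pol_norm m L f * exp (\<kappa> * (j * t))) ((Qop P Z a b \<sigma> t ^^ j) f) F" ..
      from step[OF t this] show ?case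
        by (simp add: mult.assoc exp_add[symmetric] algebra_simps)
    qed
    then obtain F where F: "jet m L (pol_norm m L f * exp (\<kappa> * (j * t))) ((Qop P Z a b \<sigma> t ^^ j) f) F" ..
    have "real j * t \<le> real n ^ l * t" using j t by (intro mult_right_mono) (simp_all flip: of_nat_power)
    also have "\<dots> = T" using n \<open>n \<ge> 1\<close> by (simp add: t_def)
    finally have "pol_norm m L f * exp (\<kappa> * (j * t)) \<le> pol_norm m L f * exp (\<kappa> * T)"
      using H \<kappa> by (intro mult_left_mono) (auto intro: mult_left_mono)
    note jet_imp_Cpol[OF jet_mono[OF F this]]
    then show "(Qop P Z a b \<sigma> (T / real n ^ l) ^^ j) f \<in> Cpol m L"
      "pol_norm m L ((Qop P Z a b \<sigma> (T / real n ^ l) ^^ j) f) \<le> exp (\<kappa> * T) * pol_norm m L f"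
      by (simp_all add: t_def mult.commute)
  qed
  show ?thesis
    using main by (intro exI[of _ "exp (\<kappa> * T)"]) auto
qed

end
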